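(* Let $N\ge2$, $\alpha\in(0,1)$ and $0\le p\le 1+\frac{2\alpha}{N}$. Then the problem $$(-\Delta)^\alpha u+u^p=0\ \text{ in } B_1(e_N),\qquad u=\delta_0\ \text{ in } \mathbb{R}^N\setminus B_1(e_N)$$ has no (nonnegative) weak solution.
   Context: $e_N=(0,\dots,0,1)\in\mathbb{R}^N$, $B_1(e_N)$ is the open unit ball centered at $e_N$, and $\delta_0$ is the Dirac mass at the origin. The fractional Laplacian is $(-\Delta)^\alpha u(x)=c_{N,\alpha}\lim_{\epsilon\to0^+}\int_{\mathbb{R}^N\setminus B_\epsilon(x)}\frac{u(x)-u(z)}{|z-x|^{N+2\alpha}}dz$, with $c_{N,\alpha}=\left(\int_{\mathbb{R}^N}\frac{1-\cos(z_1)}{|z|^{N+2\alpha}}dz\right)^{-1}$. Let $\Gamma_0(x)=\frac{c_{N,\alpha}}{|x|^{N+2\alpha}}$. A weak solution is a nonnegative $u\in L^1(B_1(e_N))$ with $u^p\in L^1_{\rm loc}(B_1(e_N))$ such that $\int_{B_1(e_N)}[u(-\Delta)^\alpha\xi+u^p\xi]dx=\int_{B_1(e_N)}\xi\Gamma_0dx$ for all $\xi\in C_0^\infty(B_1(e_N))$ (smooth functions on $\mathbb{R}^N$ with compact support in $B_1(e_N)$). For $p=0$, $u^0\equiv1$. *)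

theory Defs
  imports "HOL-Analysis.Analysis"
begin

fun Ck :: "nat \<Rightarrow> ('a::euclidean_space \<Rightarrow> real) \<Rightarrow> bool" where
  "Ck 0 f = continuous_on UNIV f"
| "Ck (Suc k) f = (continuous_on UNIV f \<and> f differentiable_on UNIV \<and>
      (\<forall>b\<in>Basis. Ck k (\<lambda>x. frechet_derivative f (at x) b)))"

definition smooth :: "('a::euclidean_space \<Rightarrow> real) \<Rightarrow> bool" where
  "smooth f \<longleftrightarrow> (\<forall>k. Ck k f)"

definition test_fun :: "'a::euclidean_space set \<Rightarrow> ('a \<Rightarrow> real) \<Rightarrow> bool" where
  "test_fun \<Omega> \<xi> \<longleftrightarrow> smooth \<xi> \<and> compact (closure {x. \<xi> x \<noteq> 0})
      \<and> closure {x. \<xi> x \<noteq> 0} \<subseteq> \<Omega>"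

text \<open>First standard coordinate z_1 (all basis vectors give the same constant by symmetry).\<close>
definition first_basis :: "'a::euclidean_space" where
  "first_basis = (SOME b. b \<in> Basis)"

definition frac_const :: "real \<Rightarrow> 'a::euclidean_space itself \<Rightarrow> real" where
  "frac_const \<alpha> TYPE('a) = inverse (LINT z|(lborel :: 'a measure).
       (1 - cos (z \<bullet> first_basis)) / norm z powr (real DIM('a) + 2 * \<alpha>))"

definition frac_lap :: "real \<Rightarrow> ('a::euclidean_space \<Rightarrow> real) \<Rightarrow> 'a \<Rightarrow> real" where
  "frac_lap \<alpha> u x = frac_const \<alpha> TYPE('a) *
     Lim (at_right 0) (\<lambda>\<epsilon>. LINT z:(UNIV - ball x \<epsilon>)|lborel.
          (u x - u z) / norm (z - x) powr (real DIM('a) + 2 * \<alpha>))"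

definition Gamma0 :: "real \<Rightarrow> 'a::euclidean_space \<Rightarrow> real" where
  "Gamma0 \<alpha> x = frac_const \<alpha> TYPE('a) / norm x powr (real DIM('a) + 2 * \<alpha>)"

definition upow :: "real \<Rightarrow> real \<Rightarrow> real" where
  "upow t p = (if p = 0 then 1 else t powr p)"

definition weak_solution :: "real \<Rightarrow> real \<Rightarrow> 'a::euclidean_space \<Rightarrow> ('a \<Rightarrow> real) \<Rightarrow> bool" where
  "weak_solution \<alpha> p e u \<longleftrightarrow>
     (AE x in lborel. x \<in> ball e 1 \<longrightarrow> u x \<ge> 0) \<and>
     set_integrable lborel (ball e 1) u \<and>
     (\<forall>K. compact K \<and> K \<subseteq> ball e 1 \<longrightarrow> set_integrable lborel K (\<lambda>x. upow (u x) p)) \<and>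
     (\<forall>\<xi>. test_fun (ball e 1) \<xi> \<longrightarrow>
        (LINT x:ball e 1|lborel. u x * frac_lap \<alpha> \<xi> x + upow (u x) p * \<xi> x)
        = (LINT x:ball e 1|lborel. \<xi> x * Gamma0 \<alpha> x))"

end

theory Submission
  imports Defs
begin

text \<open>
  Test the equation with bumps \<open>\<xi>\<close> of size \<open>r\<close> centred at \<open>r e\<close>. The right-hand side is of order
  \<open>r powr (- 2 \<alpha>)\<close>, whereas the term with the fractional Laplacian is
  \<open>o(r powr (- 2 \<alpha>))\<close> by dominated convergence, because \<open>u\<close> is integrable and the rescaled
  fractional Laplacian of a bump is bounded and vanishes at infinity. Hence the integral of \<open>u\<^sup>p \<xi>\<close>
  is at least of order \<open>r powr (- 2 \<alpha>)\<close>. For \<open>p \<le> 1\<close> this contradicts \<open>u\<^sup>p \<le> 1 + u\<close>.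

  For \<open>p > 1\<close> one needs \<open>u \<le> B / r\<^sup>N\<close> almost everywhere on the support of \<open>\<xi>\<close>. Since
  \<open>N (p - 1) \<le> 2 \<alpha>\<close>, this gives \<open>u\<^sup>p \<le> B' r powr (- 2 \<alpha>) u\<close> there, and the integral of \<open>u\<close> over the
  support tends to \<open>0\<close>, a contradiction. The bound holds since \<open>u\<close> is a subsolution of
  \<open>(- \<Delta>)\<^sup>\<alpha> u \<le> \<Gamma>\<^sub>0\<close>: at a maximum point of a mollification of \<open>u\<close> times a weight that vanishes on
  the boundary of a small ball, the fractional Laplacian is bounded below by the value there, up to
  the total mass.
\<close>

section \<open>Integrals of the kernel\<close>

text \<open>Since \<open>u\<close> is only integrable, its fractional Laplacian has no pointwise
  meaning and a maximum point of \<open>u\<close> cannot be used directly. Mollification repairs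
  this: a bump is an even function of the difference of centre and point, so the fractional
  Laplacian of the mollification at \<open>x\<close> is the weak formulation tested with a bump
  centred at \<open>x\<close>. The bound obtained does not depend on the mollification radius and
  therefore passes back to \<open>u\<close>. No Green function or heat kernel is involved.

  The principal value in \<open>frac_lap\<close> is replaced by an absolutely convergent integral of
  second differences, to which Fubini and dominated convergence apply.

  The balls of centre \<open>r e\<close> and radius \<open>r / 2\<close> lie in
  \<open>ball e 1\<close>, shrink to the origin, and stay at a distance comparable with
  \<open>r\<close> from it. The powers of \<open>r\<close> then match: the source is of order
  \<open>r powr (- N - 2 * \<alpha>)\<close> on such a ball, and multiplied by
  \<open>r powr (2 * \<alpha>)\<close> it has the order \<open>r powr (- N)\<close> of a fixed mass
  spread over the ball.\<close>

lemma lborel_integrable_affine: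
  fixes f :: "'a::euclidean_space \<Rightarrow> real"
  assumes "c \<noteq> 0" and f: "integrable lborel f"
  shows "integrable lborel (\<lambda>x. f (t + c *\<^sub>R x))"
  using f f[THEN borel_measurable_integrable] assms(1) unfolding integrable_iff_bounded
  by (subst (asm) lborel_affine[of c t])
     (auto simp: nn_integral_density nn_integral_distr nn_integral_cmult ennreal_mult_less_top)

lemma lborel_integrable_affine_iff:
  fixes f :: "'a::euclidean_space \<Rightarrow> real"
  assumes "c \<noteq> 0"
  shows "integrable lborel (\<lambda>x. f (t + c *\<^sub>R x)) \<longleftrightarrow> integrable lborel f"
  using lborel_integrable_affine[OF assms, of f t]
    lborel_integrable_affine[of "1/c" "\<lambda>x. f (t + c *\<^sub>R x)" "-(1/c) *\<^sub>R t"] assms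
  by (auto simp: field_simps algebra_simps)

text \<open>Integrability is invariant under the substitution, so if it fails both integrals have
  the default value 0.\<close>

lemma lborel_integral_affine:
  fixes f :: "'a::euclidean_space \<Rightarrow> real"
  assumes c: "c \<noteq> 0"
  shows "(LINT x|lborel. f x) = \<bar>c\<bar> ^ DIM('a) * (LINT x|lborel. f (t + c *\<^sub>R x))"
proof cases
  assume f[measurable]: "integrable lborel f"
  then show ?thesis
    using c f f[THEN borel_measurable_integrable] lborel_integrable_affine[OF c f, of t]
    by (subst lborel_affine[OF c, of t]) (simp add: integral_density integral_distr)
next
  assume "\<not> integrable lborel f"
  with c show ?thesis
    by (simp add: lborel_integrable_affine_iff not_integrable_integral_eq)
qed


text \<open>Takes the place of polar coordinates. Where \<open>f\<close> is nonzero it lies below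
  one term of the series of \<open>c n\<close> times the indicator of
  \<open>ball 0 (\<rho> n)\<close>, and the integral of that term is
  \<open>c n * \<rho> n ^ DIM('a)\<close> times the volume of the unit ball. Dyadic radii will make
  the series geometric.\<close>

lemma nn_integral_dyadic_ball_finite:
  fixes f :: "'a::euclidean_space \<Rightarrow> real" and c \<rho> :: "nat \<Rightarrow> real"
  assumes f: "\<And>z. f z \<noteq> 0 \<Longrightarrow> \<exists>n. f z \<le> c n \<and> z \<in> ball 0 (\<rho> n)"
    and c: "\<And>n. 0 \<le> c n" "\<And>n. 0 \<le> \<rho> n"
    and sm: "summable (\<lambda>n. c n * \<rho> n ^ DIM('a))"
  shows "(\<integral>\<^sup>+z. ennreal (f z) \<partial>lborel) < \<infinity>"
proof -
  define V where "V = measure lborel (ball (0::'a) 1)"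
  have V: "V \<ge> 0" by (simp add: V_def)
  have le: "ennreal (f z) \<le> (\<Sum>n. ennreal (c n) * indicator (ball 0 (\<rho> n)) z)" for z
  proof (cases "f z = 0")
    case False
    then obtain n where n: "f z \<le> c n" "z \<in> ball 0 (\<rho> n)" using f by blast
    then have "ennreal (f z) \<le> ennreal (c n) * indicator (ball 0 (\<rho> n)) z"
      by (simp add: ennreal_leI)
    also have "\<dots> = (\<Sum>k\<in>{n}. ennreal (c k) * indicator (ball 0 (\<rho> k)) z)"
      unfolding sum.insert_remove[OF finite.emptyI] by (simp del: indicator_simps mem_ball)
    also have "\<dots> \<le> (\<Sum>n. ennreal (c n) * indicator (ball 0 (\<rho> n)) z)"
      by (rule sum_le_suminf) auto
    finally show ?thesis .
  qed simp
  have "(\<integral>\<^sup>+z. ennreal (f z) \<partial>lborel)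
      \<le> (\<integral>\<^sup>+z. (\<Sum>n. ennreal (c n) * indicator (ball (0::'a) (\<rho> n)) z) \<partial>lborel)"
    by (intro nn_integral_mono le)
  also have "\<dots> = (\<Sum>n. \<integral>\<^sup>+z. ennreal (c n) * indicator (ball (0::'a) (\<rho> n)) z \<partial>lborel)"
    by (rule nn_integral_suminf) (measurable, simp)
  also have "\<dots> = (\<Sum>n. ennreal (c n * \<rho> n ^ DIM('a) * V))"
  proof (rule arg_cong[where f=suminf], rule ext)
    fix n
    have "emeasure lborel (ball (0::'a) (\<rho> n)) = ennreal (\<rho> n ^ DIM('a) * V)"
      using content_ball_conv_unit_ball[of "\<rho> n" "0::'a"] c(2)[of n] emeasure_lborel_ball_finite[of "0::'a" "\<rho> n"]
      by (subst emeasure_eq_ennreal_measure) (auto simp: V_def)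
    then show "(\<integral>\<^sup>+z. ennreal (c n) * indicator (ball (0::'a) (\<rho> n)) z \<partial>lborel) = ennreal (c n * \<rho> n ^ DIM('a) * V)"
      using c V by (subst nn_integral_cmult_indicator) (simp_all add: mult.assoc flip: ennreal_mult)
  qed
  also have "(\<Sum>n. ennreal (c n * \<rho> n ^ DIM('a) * V)) < \<infinity>"
    unfolding infinity_ennreal_def less_top[symmetric]
    by (intro ennreal_suminf_neq_top summable_mult2 sm mult_nonneg_nonneg zero_le_power c V)
  finally show ?thesis .
qed

text \<open>The kernel of \<open>frac_lap\<close> without the factor \<open>frac_const\<close>. By
  the conventions for \<open>powr\<close> and division its value at the origin is 0, so the point
  \<open>z = 0\<close> never contributes.\<close>

definition frac_ker :: "real \<Rightarrow> 'a::euclidean_space \<Rightarrow> real" where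
  "frac_ker \<alpha> z = 1 / norm z powr (real DIM('a) + 2 * \<alpha>)"

lemma frac_ker_nonneg [simp]: "0 \<le> frac_ker \<alpha> z"
  by (simp add: frac_ker_def)

lemma frac_ker_measurable [measurable]: "frac_ker \<alpha> \<in> borel_measurable borel"
  unfolding frac_ker_def by measurable

lemma frac_ker_scaleR:
  fixes z :: "'a::euclidean_space"
  assumes "s > 0"
  shows "frac_ker \<alpha> (s *\<^sub>R z) = s powr (- real DIM('a) - 2 * \<alpha>) * frac_ker \<alpha> z"
proof -
  have "s powr (- real DIM('a) - 2 * \<alpha>) = 1 / s powr (real DIM('a) + 2 * \<alpha>)"
    by (simp add: powr_minus_divide[symmetric])
  then show ?thesis using assms by (simp add: frac_ker_def powr_mult)
qed

lemma frac_ker_antimono: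
  fixes z :: "'a::euclidean_space"
  assumes "0 < s" "s \<le> norm z" "0 < \<alpha>"
  shows "frac_ker \<alpha> z \<le> s powr (- real DIM('a) - 2 * \<alpha>)"
proof -
  have "s powr (- real DIM('a) - 2 * \<alpha>) = 1 / s powr (real DIM('a) + 2 * \<alpha>)"
    by (simp add: powr_minus_divide[symmetric])
  then show ?thesis using assms unfolding frac_ker_def
    by (auto intro!: divide_left_mono powr_mono2 mult_pos_pos)
qed

text \<open>On the shell between radii \<open>2 ^ n\<close> and \<open>2 ^ Suc n\<close> the kernel
  is at most its value at the inner radius. The resulting series has ratio
  \<open>2 powr (- 2 * \<alpha>)\<close>, below 1 because \<open>\<alpha> > 0\<close>.\<close>

lemma frac_ker_far_integrable1:
  assumes "0 < \<alpha>"
  shows "integrable lborel (\<lambda>z::'a::euclidean_space. indicator (- ball 0 1) z * frac_ker \<alpha> z)"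
proof (rule integrableI_nonneg)
  let ?d = "real DIM('a)"
  show "(\<integral>\<^sup>+z. ennreal (indicator (- ball 0 1) z * frac_ker \<alpha> (z::'a)) \<partial>lborel) < \<infinity>"
  proof (rule nn_integral_dyadic_ball_finite
      [where c = "\<lambda>n. (2 ^ n) powr (- ?d - 2 * \<alpha>)" and \<rho> = "\<lambda>n. 2 ^ Suc n"])
    fix z :: 'a assume "indicator (- ball 0 1) z * frac_ker \<alpha> z \<noteq> 0"
    then have z: "norm z \<ge> 1" by (auto simp: indicator_def split: if_splits)
    define n where "n = nat \<lfloor>log 2 (norm z)\<rfloor>"
    have n: "2 ^ n \<le> norm z" "norm z < 2 ^ Suc n"
    proof -
      have l: "log 2 (norm z) \<ge> 0" using z by (subst zero_le_log_cancel_iff) auto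
      then have "real n \<le> log 2 (norm z)" "log 2 (norm z) < real (Suc n)"
        unfolding n_def by linarith+
      then have "2 powr real n \<le> norm z" "norm z < 2 powr real (Suc n)"
        using z le_log_iff[of 2 "norm z" "real n"] log_less_iff[of 2 "norm z" "real (Suc n)"] by linarith+
      then show "2 ^ n \<le> norm z" "norm z < 2 ^ Suc n"
        by (simp_all add: powr_realpow[symmetric] del: power_Suc)
    qed
    have "frac_ker \<alpha> z \<le> (2 ^ n) powr (- ?d - 2 * \<alpha>)"
      using n assms by (intro frac_ker_antimono) auto
    then show "\<exists>n. indicator (- ball 0 1) z * frac_ker \<alpha> z \<le> (2 ^ n) powr (- ?d - 2 * \<alpha>) \<and> z \<in> ball 0 (2 ^ Suc n)"
      using n z by (intro exI[of _ n]) (auto simp: indicator_def)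
  next
    have e: "(2 ^ n) powr (- ?d - 2 * \<alpha>) * (2 ^ Suc n) ^ DIM('a) = 2 ^ DIM('a) * (2 powr (- 2 * \<alpha>)) ^ n" for n
    proof -
      have h: "2 ^ n = 2 powr real n" for n by (simp add: powr_realpow)
      have "(2 ^ n) powr (- ?d - 2 * \<alpha>) * (2 ^ Suc n) ^ DIM('a)
          = (2 powr real n) powr (- ?d - 2 * \<alpha>) * (2 powr real (Suc n)) powr ?d"
        unfolding h by (subst powr_realpow[symmetric]) simp_all
      also have "\<dots> = 2 powr ?d * 2 powr ((- 2 * \<alpha>) * real n)"
        unfolding powr_powr powr_add[symmetric] by (simp add: algebra_simps)
      also have "\<dots> = 2 ^ DIM('a) * (2 powr (- 2 * \<alpha>)) ^ n"
        unfolding powr_powr[symmetric] by (subst (1 2) powr_realpow) simp_all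
      finally show ?thesis .
    qed
    have "2 powr (- 2 * \<alpha>) < 2 powr (0::real)" using assms by (subst powr_less_cancel_iff) auto
    then show "summable (\<lambda>n. (2 ^ n) powr (- ?d - 2 * \<alpha>) * (2 ^ Suc n) ^ DIM('a))"
      unfolding e by (intro summable_mult summable_geometric) simp
  qed auto
qed auto

text \<open>The same with shells shrinking to the origin. The factor \<open>norm z ^ 2\<close>
  changes the ratio to \<open>2 powr (2 * \<alpha> - 2)\<close>, below 1 because
  \<open>\<alpha> < 1\<close>.\<close>

lemma frac_ker_near_integrable1:
  assumes "0 < \<alpha>" "\<alpha> < 1"
  shows "integrable lborel (\<lambda>z::'a::euclidean_space. indicator (ball 0 1) z * (norm z ^ 2 * frac_ker \<alpha> z))"
proof (rule integrableI_nonneg)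
  let ?d = "real DIM('a)"
  let ?h = "\<lambda>n. (1/2::real) ^ n"
  show "(\<integral>\<^sup>+z. ennreal (indicator (ball 0 1) z * (norm z ^ 2 * frac_ker \<alpha> (z::'a))) \<partial>lborel) < \<infinity>"
  proof (rule nn_integral_dyadic_ball_finite
      [where c = "\<lambda>n. (?h n)^2 * (?h (Suc n)) powr (- ?d - 2 * \<alpha>)" and \<rho> = "\<lambda>n. ?h n"])
    fix z :: 'a assume "indicator (ball 0 1) z * (norm z ^ 2 * frac_ker \<alpha> z) \<noteq> 0"
    then have z: "norm z < 1" "norm z > 0" by (auto simp: indicator_def split: if_splits)
    define l where "l = - log 2 (norm z)"
    \<comment> \<open>Ceiling minus one, not floor: the outer bound
      \<open>norm z < (1/2) ^ n\<close> must be strict, since the covering balls are open.\<close>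
    define n where "n = nat (\<lceil>l\<rceil> - 1)"
    have n: "?h (Suc n) \<le> norm z" "norm z < ?h n"
    proof -
      have l: "l > 0" using z by (simp add: l_def)
      then have "real n < l" "l \<le> real (Suc n)"
        unfolding n_def by linarith+
      then have "norm z < 2 powr (- real n)" "2 powr (- real (Suc n)) \<le> norm z"
        using z unfolding l_def by (subst log_less_iff[symmetric] le_log_iff[symmetric]; simp)+
      then show "?h (Suc n) \<le> norm z" "norm z < ?h n"
        by (simp_all add: powr_realpow[symmetric] powr_minus_divide power_one_over
            del: power_Suc of_nat_Suc minus_add_distrib)
    qed
    have "frac_ker \<alpha> z \<le> (?h (Suc n)) powr (- ?d - 2 * \<alpha>)"
      using n assms by (intro frac_ker_antimono) (auto simp del: power_Suc)
    then have "norm z ^ 2 * frac_ker \<alpha> z \<le> (?h n)^2 * (?h (Suc n)) powr (- ?d - 2 * \<alpha>)"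
      using n by (intro mult_mono power_mono) auto
    then show "\<exists>n. indicator (ball 0 1) z * (norm z ^ 2 * frac_ker \<alpha> z)
        \<le> (?h n)^2 * (?h (Suc n)) powr (- ?d - 2 * \<alpha>) \<and> z \<in> ball 0 (?h n)"
      using n z by (intro exI[of _ n]) (auto simp: indicator_def simp del: power_Suc)
  next
    have e: "(?h n)^2 * (?h (Suc n)) powr (- ?d - 2 * \<alpha>) * (?h n) ^ DIM('a)
        = 2 powr (?d + 2 * \<alpha>) * (2 powr (2 * \<alpha> - 2)) ^ n" for n
    proof -
      have h: "?h n = 2 powr (- real n)" for n
        by (simp add: powr_minus_divide power_one_over powr_realpow)
      have "(?h n)^2 * (?h (Suc n)) powr (- ?d - 2 * \<alpha>) * (?h n) ^ DIM('a)
          = (2 powr (- real n)) powr 2 * (2 powr (- real (Suc n))) powr (- ?d - 2 * \<alpha>) * (2 powr (- real n)) powr ?d"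
        unfolding h by (subst (1 2) powr_realpow[symmetric]) (simp_all)
      also have "\<dots> = 2 powr (?d + 2 * \<alpha>) * 2 powr ((2 * \<alpha> - 2) * real n)"
        unfolding powr_powr powr_add[symmetric] by (simp add: algebra_simps)
      also have "\<dots> = 2 powr (?d + 2 * \<alpha>) * (2 powr (2 * \<alpha> - 2)) ^ n"
        by (simp add: powr_powr[symmetric] powr_realpow[symmetric, of "2 powr _"])
      finally show ?thesis .
    qed
    have "2 powr (2 * \<alpha> - 2) < 2 powr (0::real)" using assms by (subst powr_less_cancel_iff) auto
    then show "summable (\<lambda>n. (?h n)^2 * (?h (Suc n)) powr (- ?d - 2 * \<alpha>) * (?h n) ^ DIM('a))"
      unfolding e by (intro summable_mult summable_geometric) simp
  qed auto
qed (use frac_ker_measurable[of \<alpha>] in \<open>auto intro!: borel_measurable_times borel_measurable_indicator\<close>)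

definition far_mass :: "real \<Rightarrow> 'a::euclidean_space itself \<Rightarrow> real" where
  "far_mass \<alpha> TYPE('a) = (LINT z|(lborel::'a measure). indicator (- ball 0 1) z * frac_ker \<alpha> z)"

definition near_mass :: "real \<Rightarrow> 'a::euclidean_space itself \<Rightarrow> real" where
  "near_mass \<alpha> TYPE('a) =
     (LINT z|(lborel::'a measure). indicator (ball 0 1) z * (norm z ^ 2 * frac_ker \<alpha> z))"

text \<open>Substituting \<open>s *\<^sub>R z\<close> produces \<open>s ^ DIM('a)\<close> from the
  volume and \<open>s powr (- DIM('a) - 2 * \<alpha>)\<close> from the kernel. In the near integral
  below, the weight \<open>norm z ^ 2\<close> adds a factor \<open>s ^ 2\<close>.\<close>

lemma frac_ker_far:
  fixes s :: real
  assumes "0 < \<alpha>" "0 < s"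
  shows "has_bochner_integral lborel (\<lambda>z::'a::euclidean_space. indicator (- ball 0 s) z * frac_ker \<alpha> z)
    (s powr (- 2 * \<alpha>) * far_mass \<alpha> TYPE('a))"
proof -
  let ?f = "\<lambda>z::'a. indicator (- ball 0 s) z * frac_ker \<alpha> z"
  have e: "?f (0 + s *\<^sub>R z) = s powr (- real DIM('a) - 2 * \<alpha>) * (indicator (- ball 0 1) z * frac_ker \<alpha> z)" for z
    using assms by (auto simp: frac_ker_scaleR indicator_def)
  have "integrable lborel (\<lambda>z. ?f (0 + s *\<^sub>R z))"
    unfolding e using frac_ker_far_integrable1[OF assms(1)] by (rule integrable_mult_right)
  then have 1: "integrable lborel ?f"
    using assms by (subst (asm) lborel_integrable_affine_iff) auto
  have "(LINT z|lborel. ?f z) = s ^ DIM('a) * (s powr (- real DIM('a) - 2 * \<alpha>) * far_mass \<alpha> TYPE('a))"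
    using assms by (subst lborel_integral_affine[of s _ 0]) (auto simp only: e far_mass_def integral_mult_right_zero)
  also have "\<dots> = s powr (- 2 * \<alpha>) * far_mass \<alpha> TYPE('a)"
    using assms by (simp add: powr_realpow[symmetric] mult.assoc[symmetric] powr_add[symmetric])
  finally show ?thesis using 1 by (simp add: has_bochner_integral_iff)
qed

lemma frac_ker_near:
  fixes s :: real
  assumes "0 < \<alpha>" "\<alpha> < 1" "0 < s"
  shows "has_bochner_integral lborel
    (\<lambda>z::'a::euclidean_space. indicator (ball 0 s) z * (norm z ^ 2 * frac_ker \<alpha> z))
    (s powr (2 - 2 * \<alpha>) * near_mass \<alpha> TYPE('a))"
proof -
  let ?f = "\<lambda>z::'a. indicator (ball 0 s) z * (norm z ^ 2 * frac_ker \<alpha> z)"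
  have e: "?f (0 + s *\<^sub>R z) = s ^ 2 * s powr (- real DIM('a) - 2 * \<alpha>) *
      (indicator (ball 0 1) z * (norm z ^ 2 * frac_ker \<alpha> z))" for z
    using assms by (auto simp: frac_ker_scaleR indicator_def power_mult_distrib)
  have "integrable lborel (\<lambda>z. ?f (0 + s *\<^sub>R z))"
    unfolding e using frac_ker_near_integrable1[OF assms(1,2)] by (rule integrable_mult_right)
  then have 1: "integrable lborel ?f"
    using assms by (subst (asm) lborel_integrable_affine_iff) auto
  have "(LINT z|lborel. ?f z)
      = s ^ DIM('a) * (s ^ 2 * s powr (- real DIM('a) - 2 * \<alpha>) * near_mass \<alpha> TYPE('a))"
    using assms by (subst lborel_integral_affine[of s _ 0]) (auto simp only: e near_mass_def integral_mult_right_zero)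
  also have "\<dots> = (s powr real DIM('a) * s powr 2 * s powr (- real DIM('a) - 2 * \<alpha>)) * near_mass \<alpha> TYPE('a)"
    using assms by (simp add: powr_realpow)
  also have "\<dots> = s powr (2 - 2 * \<alpha>) * near_mass \<alpha> TYPE('a)"
    unfolding powr_add[symmetric] by simp
  finally show ?thesis using 1 by (simp add: has_bochner_integral_iff)
qed

section \<open>Signs of the kernel constants\<close>

lemma near_mass_nonneg: "0 \<le> near_mass \<alpha> TYPE('a::euclidean_space)"
  unfolding near_mass_def by (intro Bochner_Integration.integral_nonneg) auto

text \<open>Strict positivity is what gives a gain at a maximum point later. A ball of radius 1 at
  distance 3 from the origin suffices: there \<open>norm z\<close> is between 2 and 4, which bounds
  the kernel from below.\<close>

lemma far_mass_pos:
  assumes "0 < \<alpha>"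
  shows "0 < far_mass \<alpha> TYPE('a::euclidean_space)"
proof -
  let ?k = "(\<lambda>z::'a. indicator (- ball 0 1) z * frac_ker \<alpha> z)"
  obtain b :: 'a where b: "b \<in> Basis" using nonempty_Basis by blast
  let ?U = "ball (3 *\<^sub>R b) 1"
  have U: "norm z \<le> 4 \<and> 2 \<le> norm z" if "z \<in> ?U" for z
  proof -
    have "dist (3 *\<^sub>R b) z < 1" using that by simp
    moreover have "norm (3 *\<^sub>R b) = 3" using b by simp
    ultimately show ?thesis
      by (smt (verit, ccfv_threshold) dist_commute dist_norm norm_triangle_ineq2 norm_triangle_ineq3)
  qed
  have "0 < (4::real) powr (- real DIM('a) - 2 * \<alpha>) * measure lborel ?U"
    using content_ball_pos[of 1 "3 *\<^sub>R b"] by simp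
  also have "\<dots> = (LINT z|lborel. 4 powr (- real DIM('a) - 2 * \<alpha>) * indicator ?U z)"
    by simp
  also have "\<dots> \<le> (LINT z|lborel. ?k z)"
  proof (rule integral_mono)
    show "integrable lborel ?k" using frac_ker_far_integrable1[OF assms] .
    show "integrable lborel (\<lambda>z. 4 powr (- real DIM('a) - 2 * \<alpha>) * indicator ?U z)"
      by (intro integrable_mult_right integrable_real_indicator) (use emeasure_lborel_ball_finite[of "3 *\<^sub>R b" 1] in \<open>simp_all add: less_top\<close>)
    fix z :: 'a
    show "4 powr (- real DIM('a) - 2 * \<alpha>) * indicator ?U z \<le> ?k z"
    proof (cases "z \<in> ?U")
      case True
      note z = U[OF True]
      have "(4::real) powr (- real DIM('a) - 2 * \<alpha>) = 1 / 4 powr (real DIM('a) + 2 * \<alpha>)"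
        by (simp add: powr_minus_divide[symmetric])
      also have "\<dots> \<le> frac_ker \<alpha> z"
        unfolding frac_ker_def using z assms by (intro divide_left_mono powr_mono2 mult_pos_pos) auto
      finally have "4 powr (- real DIM('a) - 2 * \<alpha>) \<le> frac_ker \<alpha> z" .
      moreover have "z \<in> - ball 0 1" using z by simp
      ultimately show ?thesis using True by (simp only: indicator_simps)
    qed (auto simp: indicator_def)
  qed
  finally show ?thesis by (simp add: far_mass_def)
qed

text \<open>\<open>min 1 (norm z ^ 2)\<close> is the growth of second differences of a bounded
  function with bounded second derivatives, so this is the common majorant in all later convergence
  arguments.\<close>

lemma integrable_min_frac_ker:
  assumes "0 < \<alpha>" "\<alpha> < 1"
  shows "integrable lborel (\<lambda>z::'a::euclidean_space. min 1 (norm z ^ 2) * frac_ker \<alpha> z)"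
proof -
  have "(\<lambda>z::'a. min 1 (norm z ^ 2) * frac_ker \<alpha> z) = (\<lambda>z. indicator (- ball 0 1) z * frac_ker \<alpha> z
      + indicator (ball 0 1) z * (norm z ^ 2 * frac_ker \<alpha> z))"
  proof
    fix z :: 'a
    have "norm z < 1 \<Longrightarrow> norm z ^ 2 \<le> 1" "norm z \<ge> 1 \<Longrightarrow> norm z ^ 2 \<ge> 1"
      by (auto intro: power_le_one one_le_power)
    then show "min 1 (norm z ^ 2) * frac_ker \<alpha> z = indicator (- ball 0 1) z * frac_ker \<alpha> z
      + indicator (ball 0 1) z * (norm z ^ 2 * frac_ker \<alpha> z)"
      by (cases "norm z < 1") (auto simp: indicator_def min_def)
  qed
  then show ?thesis
    using frac_ker_near_integrable1[OF assms, where 'a='a] frac_ker_far_integrable1[OF assms(1), where 'a='a] by simp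
qed

text \<open>\<open>frac_const\<close> is the inverse of an integral, so a divergent or vanishing
  integral would make it 0. Convergence follows from \<open>1 - cos t = 2 * sin (t / 2) ^ 2\<close>,
  which bounds the numerator by \<open>2 * min 1 (norm z ^ 2)\<close>.\<close>

lemma frac_const_pos:
  assumes "0 < \<alpha>" "\<alpha> < 1"
  shows "0 < frac_const \<alpha> TYPE('a::euclidean_space)"
proof -
  define b :: 'a where "b = first_basis"
  have b: "b \<in> Basis" unfolding b_def first_basis_def using nonempty_Basis by (simp add: some_in_eq)
  let ?g = "\<lambda>z::'a. (1 - cos (z \<bullet> b)) * frac_ker \<alpha> z"
  have 1: "integrable lborel ?g"
  proof (rule Bochner_Integration.integrable_bound)
    show "integrable lborel (\<lambda>z::'a. 2 * (min 1 (norm z ^ 2) * frac_ker \<alpha> z))"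
      using integrable_min_frac_ker[OF assms] by (rule integrable_mult_right)
    show "AE z in lborel. norm (?g z) \<le> norm (2 * (min 1 ((norm z)\<^sup>2) * frac_ker \<alpha> z))"
    proof (rule AE_I2)
      fix z :: 'a
      have "1 - cos (z \<bullet> b) = 2 * sin ((z \<bullet> b) / 2) ^ 2"
        using cos_double_sin[of "(z \<bullet> b) / 2"] by simp
      moreover have "\<bar>sin ((z \<bullet> b) / 2)\<bar> \<le> \<bar>(z \<bullet> b) / 2\<bar>" by (rule abs_sin_x_le_abs_x)
      moreover have "\<bar>z \<bullet> b\<bar> \<le> norm z" using b Basis_le_norm by blast
      ultimately have "1 - cos (z \<bullet> b) \<le> 2 * norm z ^ 2"
        using power2_le_iff_abs_le[of "norm z" "sin ((z \<bullet> b)/2)"] by simp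
      moreover have "1 - cos (z \<bullet> b) \<le> 2 * 1" using cos_ge_minus_one[of "z \<bullet> b"] by simp
      ultimately have "\<bar>1 - cos (z \<bullet> b)\<bar> \<le> 2 * min 1 (norm z ^ 2)" by (auto simp: min_def)
      then show "norm (?g z) \<le> norm (2 * (min 1 ((norm z)\<^sup>2) * frac_ker \<alpha> z))"
        by (simp add: abs_mult mult.assoc[symmetric] mult_right_mono)
    qed
  qed measurable
  have "integral\<^sup>L lborel ?g \<noteq> 0"
  proof
    assume "integral\<^sup>L lborel ?g = 0"
    then have ae: "AE z in lborel. ?g z = 0"
      using integral_nonneg_eq_0_iff_AE[OF 1] by (auto simp: mult_nonneg_nonneg)
    \<comment> \<open>On this ball \<open>z \<bullet> b\<close> lies in the interval from 2 to 4,
      strictly between 0 and \<open>2 * pi\<close>, so the cosine is below 1.\<close>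
    let ?U = "ball (3 *\<^sub>R b) 1"
    have "AE z in lborel. z \<notin> ?U"
      using ae
    proof eventually_elim
      case (elim z)
      show "z \<notin> ?U"
      proof
        assume z: "z \<in> ?U"
        have "\<bar>(3 *\<^sub>R b - z) \<bullet> b\<bar> < 1"
          using z Basis_le_norm[OF b, of "3 *\<^sub>R b - z"] by (simp add: dist_norm)
        then have zb: "2 < z \<bullet> b" "z \<bullet> b < 4" using b by (auto simp: inner_diff_left)
        then have "z \<noteq> 0" by auto
        then have "cos (z \<bullet> b) = 1" using elim by (auto simp: frac_ker_def)
        then have "cos (z \<bullet> b - 2 * pi) = 1" by (simp add: cos_diff)
        moreover have "cos (2 * pi - z \<bullet> b) < 1"
          using zb pi_gt3 pi_less_4 cos_monotone_0_pi[of 0 "2 * pi - z \<bullet> b"]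
            cos_monotone_0_pi[of 0 "z \<bullet> b"] \<open>cos (z \<bullet> b) = 1\<close>
          by (cases "z \<bullet> b \<le> pi") auto
        ultimately show False by (metis cos_minus less_irrefl minus_diff_eq)
      qed
    qed
    then have "emeasure lborel ?U = 0"
      by (subst (asm) AE_iff_measurable[of ?U]) auto
    then have "measure lborel ?U = 0" by (simp add: measure_def)
    with content_ball_pos[of 1 "3 *\<^sub>R b"] show False by simp
  qed
  moreover have "integral\<^sup>L lborel ?g \<ge> 0" by (intro Bochner_Integration.integral_nonneg) auto
  ultimately have "integral\<^sup>L lborel ?g > 0" by linarith
  then show ?thesis by (simp add: frac_const_def frac_ker_def b_def)
qed

section \<open>Bump functions\<close>

text \<open>For \<open>k = 0\<close> this is the classical smooth function that is flat at 0. The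
  powers of \<open>1 / t\<close> are included so that derivatives are linear combinations of members
  of the same family.\<close>

definition flat_exp :: "nat \<Rightarrow> real \<Rightarrow> real" where
  "flat_exp k t = (if t > 0 then (1 / t) ^ k * exp (- (1 / t)) else 0)"

lemma power_exp_minus_le_fact:
  assumes "(x::real) \<ge> 0"
  shows "x ^ k * exp (- x) \<le> fact k"
proof -
  have "(\<Sum>n\<in>{k}. inverse (fact n) *\<^sub>R x ^ n) \<le> (\<Sum>n. inverse (fact n) *\<^sub>R x ^ n)"
    using assms by (intro sum_le_suminf summable_exp_generic) auto
  then have "x ^ k / fact k \<le> exp x" by (simp add: exp_def field_simps)
  then show ?thesis by (simp add: exp_minus field_simps)
qed

lemma flat_exp_nonneg [simp]: "0 \<le> flat_exp k t"
  by (simp add: flat_exp_def)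

lemma flat_exp_le_fact: "flat_exp k t \<le> fact k"
  using power_exp_minus_le_fact[of "1 / t" k] by (simp add: flat_exp_def)

lemma flat_exp_0_le_1: "flat_exp 0 t \<le> 1"
  by (simp add: flat_exp_def)

text \<open>For \<open>t > 0\<close> one has
  \<open>flat_exp k t = t ^ 2 * flat_exp (k + 2) t\<close>, and the last factor is bounded.
  Quadratic decay makes the derivative at 0 vanish.\<close>

lemma flat_exp_le_square: "flat_exp k t \<le> fact (k + 2) * t ^ 2"
proof (cases "t > 0")
  case True
  then have "(1 / t) ^ k = t ^ 2 * (1 / t) ^ (k + 2)"
    by (simp add: power_add power2_eq_square)
  then have "flat_exp k t = t ^ 2 * flat_exp (k + 2) t"
    using True by (simp only: flat_exp_def if_True mult.assoc)
  also have "\<dots> \<le> t ^ 2 * fact (k + 2)"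
    by (intro mult_left_mono flat_exp_le_fact) simp
  finally show ?thesis by (simp add: mult.commute)
qed (simp add: flat_exp_def)

lemma DERIV_flat_exp:
  "(flat_exp k has_real_derivative (flat_exp (k + 2) t - real k * flat_exp (k + 1) t)) (at t)"
proof -
  consider "t > 0" | "t < 0" | "t = 0" by linarith
  then show ?thesis
  proof cases
    case 1
    have "((\<lambda>t. (1 / t) ^ k * exp (- (1 / t))) has_real_derivative
        (flat_exp (k + 2) t - real k * flat_exp (k + 1) t)) (at t)"
    proof (cases k)
      case 0
      with 1 show ?thesis
        by (auto intro!: derivative_eq_intros simp: flat_exp_def field_simps power2_eq_square)
    next
      case (Suc m)
      with 1 show ?thesis
        by (auto intro!: derivative_eq_intros simp: flat_exp_def field_simps power2_eq_square)
          (cases m; simp add: field_simps)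
    qed
    then show ?thesis
      by (rule has_field_derivative_transform_within_open[where S="{0<..}"])
        (use 1 in \<open>auto simp: flat_exp_def\<close>)
  next
    case 2
    have "((\<lambda>t. 0) has_real_derivative (flat_exp (k + 2) t - real k * flat_exp (k + 1) t)) (at t)"
      using 2 by (simp add: flat_exp_def)
    then show ?thesis
      by (rule has_field_derivative_transform_within_open[where S="{..<0}"])
        (use 2 in \<open>auto simp: flat_exp_def\<close>)
  next
    case 3
    have "((\<lambda>y. (flat_exp k y - flat_exp k 0) / (y - 0)) \<longlongrightarrow> 0) (at 0)"
    proof (rule Lim_null_comparison)
      show "\<forall>\<^sub>F y in at 0. norm ((flat_exp k y - flat_exp k 0) / (y - 0)) \<le> fact (k + 2) * \<bar>y\<bar>"
      proof (rule eventuallyI)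
        fix y :: real
        show "norm ((flat_exp k y - flat_exp k 0) / (y - 0)) \<le> fact (k + 2) * \<bar>y\<bar>"
        proof (cases "y = 0")
          case False
          have "norm ((flat_exp k y - flat_exp k 0) / (y - 0)) = flat_exp k y / \<bar>y\<bar>"
            by (simp add: flat_exp_def abs_mult)
          also have "\<dots> \<le> fact (k + 2) * y ^ 2 / \<bar>y\<bar>"
            by (intro divide_right_mono flat_exp_le_square) simp
          also have "\<dots> = fact (k + 2) * \<bar>y\<bar>"
            using False by (simp add: power2_eq_square abs_if field_simps del: fact_Suc)
          finally show ?thesis .
        qed simp
      qed
      show "((\<lambda>y. fact (k + 2) * \<bar>y\<bar>) \<longlongrightarrow> (0::real)) (at 0)"
        by (auto intro!: tendsto_eq_intros)
    qed
    then show ?thesis using 3 by (simp add: has_field_derivative_iff flat_exp_def)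
  qed
qed

text \<open>The standard bump on \<open>ball c s\<close>, not normalised: its value at the centre is
  \<open>exp (- 1)\<close>. The squared distance is written as an inner product, hence is visibly a
  polynomial in \<open>x\<close>.\<close>

definition bump :: "'a::euclidean_space \<Rightarrow> real \<Rightarrow> 'a \<Rightarrow> real" where
  "bump c s x = flat_exp 0 (1 - (x - c) \<bullet> (x - c) / s ^ 2)"

text \<open>The partial derivatives of a bump function stay in the algebra generated by the functions
  below, whence smoothness.\<close>

inductive bump_alg :: "'a::euclidean_space \<Rightarrow> real \<Rightarrow> ('a \<Rightarrow> real) \<Rightarrow> bool" for c s where
  const: "bump_alg c s (\<lambda>_. a)"
| coord: "bump_alg c s (\<lambda>x. x \<bullet> b)"
| flat: "bump_alg c s (\<lambda>x. flat_exp k (1 - (x - c) \<bullet> (x - c) / s ^ 2))"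
| add: "bump_alg c s f \<Longrightarrow> bump_alg c s g \<Longrightarrow> bump_alg c s (\<lambda>x. f x + g x)"
| mult: "bump_alg c s f \<Longrightarrow> bump_alg c s g \<Longrightarrow> bump_alg c s (\<lambda>x. f x * g x)"

lemma bump_alg_derivative:
  assumes "bump_alg c s f"
  shows "\<exists>f'. (\<forall>x. (f has_derivative f' x) (at x)) \<and> (\<forall>b. bump_alg c s (\<lambda>x. f' x b))"
  using assms
proof induction
  case (const a)
  show ?case by (rule exI[of _ "\<lambda>x h. 0"]) (auto intro: bump_alg.const)
next
  case (coord b)
  show ?case
    by (rule exI[of _ "\<lambda>x h. h \<bullet> b"]) (auto intro!: bump_alg.const derivative_eq_intros)
next
  case (flat k)
  let ?q = "\<lambda>x::'a. 1 - (x - c) \<bullet> (x - c) / s ^ 2"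
  \<comment> \<open>The derivative is written with sums and products only, and with constants as
    separate factors, to match the introduction rules of \<open>bump_alg\<close>, which has no
    subtraction.\<close>
  let ?f' = "\<lambda>x h. (flat_exp (k + 2) (?q x) + (- real k) * flat_exp (k + 1) (?q x)) *
      ((x \<bullet> h) * (- 2 / s ^ 2) + 2 * (c \<bullet> h) / s ^ 2)"
  show ?case
  proof (intro exI[of _ ?f'] conjI allI)
    fix x
    have "(?q has_derivative (\<lambda>h. (x \<bullet> h) * (- 2 / s ^ 2) + 2 * (c \<bullet> h) / s ^ 2)) (at x)"
      unfolding divide_inverse
      by (rule derivative_eq_intros refl)+
        (simp add: fun_eq_iff inner_diff_left inner_diff_right inner_commute algebra_simps)
    from has_derivative_compose[OF this DERIV_flat_exp[unfolded has_field_derivative_def, of k]]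
    show "((\<lambda>x. flat_exp k (?q x)) has_derivative ?f' x) (at x)"
      by (simp add: algebra_simps)
  next
    fix b :: 'a
    show "bump_alg c s (\<lambda>x. ?f' x b)"
      by (intro bump_alg.intros)
  qed
next
  case (add f g)
  then obtain f' g' where "\<forall>x. (f has_derivative f' x) (at x)" "\<forall>b. bump_alg c s (\<lambda>x. f' x b)"
    "\<forall>x. (g has_derivative g' x) (at x)" "\<forall>b. bump_alg c s (\<lambda>x. g' x b)" by blast
  then show ?case
    by (intro exI[of _ "\<lambda>x h. f' x h + g' x h"])
      (auto intro!: bump_alg.add has_derivative_add)
next
  case (mult f g)
  then obtain f' g' where "\<forall>x. (f has_derivative f' x) (at x)" "\<forall>b. bump_alg c s (\<lambda>x. f' x b)"
    "\<forall>x. (g has_derivative g' x) (at x)" "\<forall>b. bump_alg c s (\<lambda>x. g' x b)" by blast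
  with mult show ?case
    by (intro exI[of _ "\<lambda>x h. f x * g' x h + f' x h * g x"])
      (auto intro!: bump_alg.add bump_alg.mult has_derivative_mult)
qed

lemma bump_alg_Ck: "bump_alg c s f \<Longrightarrow> Ck k f"
proof (induction k arbitrary: f)
  case 0
  then obtain f' where "\<forall>x. (f has_derivative f' x) (at x)" using bump_alg_derivative by blast
  then show ?case
    by (auto intro!: continuous_at_imp_continuous_on has_derivative_continuous)
next
  case (Suc k)
  then obtain f' where f': "\<forall>x. (f has_derivative f' x) (at x)" "\<forall>b. bump_alg c s (\<lambda>x. f' x b)"
    using bump_alg_derivative by blast
  then have "frechet_derivative f (at x) = f' x" for x
    by (metis frechet_derivative_at)
  moreover have "continuous_on UNIV f"
    using f' by (auto intro!: continuous_at_imp_continuous_on has_derivative_continuous)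
  moreover have "f differentiable_on UNIV"
    using f' by (auto simp: differentiable_on_def differentiable_def intro: has_derivative_at_withinI)
  ultimately show ?case using Suc.IH f'(2) by simp
qed

lemma smooth_bump: "smooth (bump c s)"
  unfolding smooth_def bump_def[abs_def] using bump_alg_Ck[OF bump_alg.flat] by blast

lemma continuous_on_bump: "continuous_on UNIV (bump c s)"
  using smooth_bump[of c s] unfolding smooth_def by (metis Ck.simps(1))

lemma bump_measurable [measurable]: "bump c s \<in> borel_measurable borel"
  by (rule borel_measurable_continuous_onI[OF continuous_on_bump])

lemma bump_nonneg [simp]: "0 \<le> bump c s x"
  by (simp add: bump_def)

lemma bump_le_1: "bump c s x \<le> 1"
  by (simp add: bump_def flat_exp_0_le_1)

lemma bump_commute: "bump c s x = bump x s c"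
  by (simp add: bump_def inner_diff_left inner_diff_right inner_commute algebra_simps)

lemma bump_eq_0_iff:
  assumes "s > 0"
  shows "bump c s x = 0 \<longleftrightarrow> x \<notin> ball c s"
proof -
  have "bump c s x = 0 \<longleftrightarrow> \<not> (norm (x - c)) ^ 2 < s ^ 2"
    using assms by (simp add: bump_def flat_exp_def dot_square_norm)
  also have "\<dots> \<longleftrightarrow> x \<notin> ball c s"
    using assms power_strict_mono[of "norm (x - c)" s 2] power_mono[of s "norm (x - c)" 2]
    by (auto simp: dist_norm norm_minus_commute not_less)
  finally show ?thesis .
qed

lemma test_fun_bump:
  assumes "s > 0" "cball c s \<subseteq> \<Omega>"
  shows "test_fun \<Omega> (bump c s)"
proof -
  have "{x. bump c s x \<noteq> 0} = ball c s" 
    by (simp add: bump_eq_0_iff[OF assms(1)] ball_def)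
  then show ?thesis using assms smooth_bump[of c s] by (simp add: test_fun_def)
qed

section \<open>Second differences of bumps\<close>

lemma bump_affine:
  assumes "s > 0"
  shows "bump c (s * \<rho>) (c + s *\<^sub>R y) = bump 0 \<rho> y"
  using assms by (simp add: bump_def power2_eq_square)

text \<open>The derivative of \<open>flat_exp 0\<close> is \<open>flat_exp 2\<close>, whose own
  derivative \<open>flat_exp 4 - 2 * flat_exp 3\<close> is at most \<open>24 + 2 * 6 = 36\<close> in
  absolute value. Two applications of the mean value inequality give the remainder.\<close>

lemma flat_exp_taylor:
  "\<bar>flat_exp 0 t - flat_exp 0 a - flat_exp 2 a * (t - a)\<bar> \<le> 36 * (t - a) ^ 2"
proof -
  have lip: "\<bar>flat_exp 2 x - flat_exp 2 y\<bar> \<le> 36 * \<bar>x - y\<bar>" for x y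
  proof -
    have "norm (flat_exp 2 x - flat_exp 2 y) \<le> 36 * norm (x - y)"
    proof (rule field_differentiable_bound[where S=UNIV])
      fix z :: real
      show "(flat_exp 2 has_field_derivative flat_exp 4 z - 2 * flat_exp 3 z) (at z within UNIV)"
        using DERIV_flat_exp[of 2 z] by simp
      have "0 \<le> flat_exp 4 z" "flat_exp 4 z \<le> 24" "0 \<le> flat_exp 3 z" "flat_exp 3 z \<le> 6"
        using flat_exp_le_fact[of 4 z] flat_exp_le_fact[of 3 z] by (simp_all add: fact_numeral)
      then show "norm (flat_exp 4 z - 2 * flat_exp 3 z) \<le> 36"
        unfolding real_norm_def abs_le_iff by linarith
    qed auto
    then show ?thesis by simp
  qed
  let ?g = "\<lambda>x. flat_exp 0 x - flat_exp 2 a * x"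
  have "norm (?g t - ?g a) \<le> (36 * \<bar>t - a\<bar>) * norm (t - a)"
  proof (rule field_differentiable_bound[where S="closed_segment a t"])
    fix z assume z: "z \<in> closed_segment a t"
    show "(?g has_field_derivative flat_exp 2 z - flat_exp 2 a) (at z within closed_segment a t)"
      using DERIV_diff[OF DERIV_flat_exp[of 0 z] DERIV_cmult[OF DERIV_ident], of "flat_exp 2 a"]
      by (simp add: has_field_derivative_at_within numeral_2_eq_2)
    have "norm (z - a) \<le> norm (t - a)" by (rule segment_bound(1)[OF z])
    then show "norm (flat_exp 2 z - flat_exp 2 a) \<le> 36 * \<bar>t - a\<bar>"
      using lip[of z a] by simp
  qed auto
  moreover have "?g t - ?g a = flat_exp 0 t - flat_exp 0 a - flat_exp 2 a * (t - a)"
    by (simp add: algebra_simps)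
  ultimately show ?thesis by (simp add: power2_eq_square mult.assoc abs_mult[symmetric])
qed

text \<open>The constant is \<open>2 * 36 * 25 + 2 * 2\<close>: two Taylor remainders with increments at most
  \<open>5 * norm z\<close>, and a first-order term bounded by \<open>flat_exp 2 \<le> 2\<close>.\<close>

lemma bump_second_difference_unit:
  "\<bar>2 * bump 0 1 x - bump 0 1 (x + z) - bump 0 1 (x - z)\<bar> \<le> 1804 * min 1 (norm z ^ 2)"
proof (cases "norm z < 1")
  case False
  then have "min 1 (norm z ^ 2) = 1" by (simp add: min_def power_le_one one_le_power antisym)
  moreover have "\<bar>2 * bump 0 1 x - bump 0 1 (x + z) - bump 0 1 (x - z)\<bar> \<le> 2"
    using bump_nonneg[of 0 1 x] bump_nonneg[of 0 1 "x + z"] bump_nonneg[of 0 1 "x - z"]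
     bump_le_1[of 0 1 x] bump_le_1[of 0 1 "x + z"] bump_le_1[of 0 1 "x - z"] by linarith
  ultimately show ?thesis by simp
next
  case z: True
  then have m: "min 1 (norm z ^ 2) = norm z ^ 2" using power_le_one[of "norm z" 2] by simp
  show ?thesis
  proof (cases "norm x < 2")
    case False
    have "norm (x + z) \<ge> 1" "norm (x - z) \<ge> 1"
      using False z norm_triangle_ineq2[of x z] norm_diff_ineq[of x z] by linarith+
    then have "bump 0 1 x = 0" "bump 0 1 (x + z) = 0" "bump 0 1 (x - z) = 0"
      using False by (subst bump_eq_0_iff; simp)+
    then show ?thesis by simp
  next
    case x: True
    define a where "a = 1 - x \<bullet> x"
    define d where "d = z \<bullet> z"
    define k where "k = 2 * (x \<bullet> z)"
    have b: "bump 0 1 x = flat_exp 0 a" "bump 0 1 (x + z) = flat_exp 0 (a - d - k)"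
      "bump 0 1 (x - z) = flat_exp 0 (a - d + k)"
      by (simp_all add: bump_def a_def d_def k_def inner_add_left inner_add_right inner_diff_left inner_diff_right
          inner_commute algebra_simps)
    have d: "d = norm z ^ 2" "d \<ge> 0" by (simp_all add: d_def dot_square_norm)
    have "d \<le> norm z" using z unfolding d by (simp add: power2_eq_square mult_left_le)
    moreover have "\<bar>k\<bar> \<le> 4 * norm z"
    proof -
      have "\<bar>x \<bullet> z\<bar> \<le> norm x * norm z" by (rule Cauchy_Schwarz_ineq2)
      also have "\<dots> \<le> 2 * norm z" using x by (intro mult_right_mono) auto
      finally show ?thesis by (simp add: k_def abs_mult)
    qed
    ultimately have "\<bar>- d - k\<bar> \<le> 5 * norm z" "\<bar>- d + k\<bar> \<le> 5 * norm z" using d(2) by linarith+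
    then have sq: "(- d - k) ^ 2 \<le> 25 * d" "(- d + k) ^ 2 \<le> 25 * d"
      unfolding d using power2_le_iff_abs_le[of "5 * norm z"] by (auto simp: power_mult_distrib)
    have t1: "\<bar>flat_exp 0 (a - d - k) - flat_exp 0 a - flat_exp 2 a * (- d - k)\<bar> \<le> 900 * d"
      using flat_exp_taylor[of "a - d - k" a] sq(1) by (simp add: algebra_simps)
    have t2: "\<bar>flat_exp 0 (a - d + k) - flat_exp 0 a - flat_exp 2 a * (- d + k)\<bar> \<le> 900 * d"
      using flat_exp_taylor[of "a - d + k" a] sq(2) by (simp add: algebra_simps)
    have f2: "0 \<le> flat_exp 2 a * d" "flat_exp 2 a * d \<le> 2 * d"
      using flat_exp_le_fact[of 2 a] d(2) by (auto simp: fact_2 intro!: mult_right_mono)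
    \<comment> \<open>The increments are \<open>- d - k\<close> and \<open>- d + k\<close>: the
      terms in \<open>k\<close>, of first order in \<open>z\<close>, cancel, and \<open>d\<close> is
      already quadratic.\<close>
    have e: "flat_exp 2 a * (- d - k) + flat_exp 2 a * (- d + k) = - 2 * (flat_exp 2 a * d)"
      by (simp add: algebra_simps)
    have m': "min 1 (norm z ^ 2) = d" using m d(1) by simp
    show ?thesis unfolding m' b using t1 t2 f2 e unfolding abs_le_iff by linarith
  qed
qed

text \<open>By rescaling to radius 1. The constant depends on \<open>s\<close> but on neither
  \<open>c\<close> nor \<open>x\<close>, which yields the uniform bounds needed for Fubini.\<close>

lemma bump_second_difference:
  assumes "s > 0"
  shows "\<bar>2 * bump c s x - bump c s (x + z) - bump c s (x - z)\<bar>
     \<le> 1804 * max 1 (1 / s ^ 2) * min 1 (norm z ^ 2)"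
proof -
  have b: "bump c s y = bump 0 1 ((1 / s) *\<^sub>R (y - c))" for y
    using bump_affine[OF assms, of c 1 "(1 / s) *\<^sub>R (y - c)"] assms by simp
  let ?z = "(1 / s) *\<^sub>R z"
  have "\<bar>2 * bump c s x - bump c s (x + z) - bump c s (x - z)\<bar> \<le> 1804 * min 1 (norm ?z ^ 2)"
    using bump_second_difference_unit[of "(1 / s) *\<^sub>R (x - c)" ?z]
    unfolding b by (simp add: algebra_simps)
  also have "min 1 (norm ?z ^ 2) \<le> max 1 (1 / s ^ 2) * min 1 (norm z ^ 2)"
  proof -
    have "norm ?z ^ 2 = 1 / s ^ 2 * norm z ^ 2" using assms by (simp add: power_divide)
    also have "\<dots> \<le> max 1 (1 / s ^ 2) * norm z ^ 2" by (intro mult_right_mono) auto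
    finally show ?thesis by (cases "norm z ^ 2 \<le> 1") (auto simp: min.coboundedI1 min.coboundedI2)
  qed
  finally show ?thesis by simp
qed

section \<open>The fractional Laplacian by second differences\<close>

text \<open>Averaging over \<open>z\<close> and \<open>- z\<close> removes the first-order term, so
  no principal value is needed for functions with quadratic second differences. For bumps it is
  \<open>2 / frac_const\<close> times the fractional Laplacian.\<close>

definition frac_lap2 :: "real \<Rightarrow> ('a::euclidean_space \<Rightarrow> real) \<Rightarrow> 'a \<Rightarrow> real" where
  "frac_lap2 \<alpha> f x = (LINT z|lborel. (2 * f x - f (x + z) - f (x - z)) * frac_ker \<alpha> z)"

lemma frac_lap2_integrable:
  fixes f :: "'a::euclidean_space \<Rightarrow> real"
  assumes "0 < \<alpha>" "\<alpha> < 1" and [measurable]: "f \<in> borel_measurable borel"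
    and d: "\<And>z. \<bar>2 * f x - f (x + z) - f (x - z)\<bar> \<le> C * min 1 (norm z ^ 2)"
  shows "integrable lborel (\<lambda>z. (2 * f x - f (x + z) - f (x - z)) * frac_ker \<alpha> z)"
proof (rule Bochner_Integration.integrable_bound)
  show "integrable lborel (\<lambda>z::'a. C * (min 1 (norm z ^ 2) * frac_ker \<alpha> z))"
    using integrable_min_frac_ker[OF assms(1,2)] by (rule integrable_mult_right)
  show "AE z in lborel. norm ((2 * f x - f (x + z) - f (x - z)) * frac_ker \<alpha> z)
      \<le> norm (C * (min 1 ((norm z)\<^sup>2) * frac_ker \<alpha> z))"
  proof (rule AE_I2)
    fix z :: 'a
    have "norm ((2 * f x - f (x + z) - f (x - z)) * frac_ker \<alpha> z)
        \<le> (C * min 1 (norm z ^ 2)) * frac_ker \<alpha> z"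
      unfolding real_norm_def abs_mult abs_of_nonneg[OF frac_ker_nonneg]
      by (intro mult_right_mono d frac_ker_nonneg)
    then show "norm ((2 * f x - f (x + z) - f (x - z)) * frac_ker \<alpha> z)
      \<le> norm (C * (min 1 ((norm z)\<^sup>2) * frac_ker \<alpha> z))"
      unfolding real_norm_def mult.assoc by (rule order_trans[OF _ abs_ge_self])
  qed
qed measurable

text \<open>The absolute value stands inside the integral because this bound serves as the
  hypothesis of Fubini's theorem in \<open>frac_lap2_mollify\<close>.\<close>

lemma frac_lap2_bound:
  fixes f :: "'a::euclidean_space \<Rightarrow> real"
  assumes "0 < \<alpha>" "\<alpha> < 1" and "f \<in> borel_measurable borel"
    and d: "\<And>z. \<bar>2 * f x - f (x + z) - f (x - z)\<bar> \<le> C * min 1 (norm z ^ 2)"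
  shows "(LINT z|lborel. \<bar>(2 * f x - f (x + z) - f (x - z)) * frac_ker \<alpha> z\<bar>)
    \<le> C * (LINT z|(lborel::'a measure). min 1 (norm z ^ 2) * frac_ker \<alpha> z)"
proof -
  have "(LINT z|lborel. \<bar>(2 * f x - f (x + z) - f (x - z)) * frac_ker \<alpha> z\<bar>)
    \<le> (LINT z|(lborel::'a measure). C * (min 1 (norm z ^ 2) * frac_ker \<alpha> z))"
  proof (rule integral_mono)
    show "integrable lborel (\<lambda>z. \<bar>(2 * f x - f (x + z) - f (x - z)) * frac_ker \<alpha> z\<bar>)"
      by (intro integrable_abs frac_lap2_integrable[OF assms])
    show "integrable lborel (\<lambda>z::'a. C * (min 1 (norm z ^ 2) * frac_ker \<alpha> z))"
      using integrable_min_frac_ker[OF assms(1,2)] by (rule integrable_mult_right)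
    show "\<bar>(2 * f x - f (x + z) - f (x - z)) * frac_ker \<alpha> z\<bar> \<le> C * (min 1 (norm z ^ 2) * frac_ker \<alpha> z)" for z
      unfolding abs_mult abs_of_nonneg[OF frac_ker_nonneg] mult.assoc[symmetric]
      by (intro mult_right_mono d frac_ker_nonneg)
  qed
  then show ?thesis by simp
qed

text \<open>For each truncation radius the substitutions \<open>x + z\<close> and
  \<open>x - z\<close> express the same truncated integral; their sum is the truncated integral of
  second differences, which converges by dominated convergence. Existence of the limit has to be
  shown, as \<open>Lim\<close> is otherwise unspecified.\<close>

lemma frac_lap_eq:
  fixes f :: "'a::euclidean_space \<Rightarrow> real"
  assumes \<alpha>: "0 < \<alpha>" "\<alpha> < 1" and [measurable]: "f \<in> borel_measurable borel"
    and bd: "\<And>z. \<bar>f z\<bar> \<le> B"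
    and d: "\<And>z. \<bar>2 * f x - f (x + z) - f (x - z)\<bar> \<le> C * min 1 (norm z ^ 2)"
  shows "frac_lap \<alpha> f x = frac_const \<alpha> TYPE('a) / 2 * frac_lap2 \<alpha> f x"
proof -
  let ?I = "\<lambda>\<epsilon>. LINT z:(UNIV - ball x \<epsilon>)|lborel. (f x - f z) / norm (z - x) powr (real DIM('a) + 2 * \<alpha>)"
  let ?S = "\<lambda>\<epsilon>. LINT z|lborel. indicator (- ball 0 \<epsilon>) z * ((2 * f x - f (x + z) - f (x - z)) * frac_ker \<alpha> z)"
  have I: "?I \<epsilon> = ?S \<epsilon> / 2" if "\<epsilon> > 0" for \<epsilon>
  proof -
    let ?k = "\<lambda>z::'a. indicator (- ball 0 \<epsilon>) z * frac_ker \<alpha> z"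
    let ?F = "\<lambda>z. indicator (UNIV - ball x \<epsilon>) z *\<^sub>R ((f x - f z) / norm (z - x) powr (real DIM('a) + 2 * \<alpha>))"
    have k: "integrable lborel ?k" using frac_ker_far[OF \<alpha>(1) that, where 'a='a] by (simp add: has_bochner_integral_iff)
    have int: "integrable lborel (\<lambda>z. ?k z * (f x - f (x + c *\<^sub>R z)))" for c
    proof (rule Bochner_Integration.integrable_bound)
      show "integrable lborel (\<lambda>z. ?k z * (2 * B))" using k by (rule integrable_mult_left)
      show "AE z in lborel. norm (?k z * (f x - f (x + c *\<^sub>R z))) \<le> norm (?k z * (2 * B))"
      proof (rule AE_I2)
        fix z
        have "\<bar>f x - f (x + c *\<^sub>R z)\<bar> \<le> \<bar>2 * B\<bar>" using bd[of x] bd[of "x + c *\<^sub>R z"] by linarith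
        then show "norm (?k z * (f x - f (x + c *\<^sub>R z))) \<le> norm (?k z * (2 * B))"
          unfolding real_norm_def abs_mult by (intro mult_left_mono) auto
      qed
    qed measurable
    have A: "?I \<epsilon> = (LINT z|lborel. ?k z * (f x - f (x + c *\<^sub>R z)))" if c: "\<bar>c\<bar> = 1" for c
    proof -
      have "?I \<epsilon> = \<bar>c\<bar> ^ DIM('a) * (LINT z|lborel. ?F (x + c *\<^sub>R z))"
        unfolding set_lebesgue_integral_def using c by (intro lborel_integral_affine) auto
      also have "(\<lambda>z. ?F (x + c *\<^sub>R z)) = (\<lambda>z. ?k z * (f x - f (x + c *\<^sub>R z)))"
        using c by (auto simp: fun_eq_iff indicator_def frac_ker_def dist_norm)
      finally show ?thesis using c by simp
    qed
    have "?S \<epsilon> = (LINT z|lborel. ?k z * (f x - f (x + 1 *\<^sub>R z)) + ?k z * (f x - f (x + (- 1) *\<^sub>R z)))"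
      by (rule Bochner_Integration.integral_cong) (auto simp: algebra_simps)
    also have "\<dots> = ?I \<epsilon> + ?I \<epsilon>"
      by (subst Bochner_Integration.integral_add[OF int int]) (use A[of 1] A[of "- 1"] in simp)
    finally show ?thesis by simp
  qed
  \<comment> \<open>The radius is written as \<open>inverse t\<close> to use dominated convergence
    for a real parameter tending to infinity.\<close>
  have "((\<lambda>t. ?S (inverse t)) \<longlongrightarrow> frac_lap2 \<alpha> f x) at_top"
    unfolding frac_lap2_def
  proof (rule integral_dominated_convergence_at_top)
    show "integrable lborel (\<lambda>z. \<bar>(2 * f x - f (x + z) - f (x - z)) * frac_ker \<alpha> z\<bar>)"
      using frac_lap2_integrable[OF \<alpha> assms(3) d] by (rule integrable_abs)
    show "AE z in lborel. ((\<lambda>t. indicator (- ball 0 (inverse t)) z * ((2 * f x - f (x + z) - f (x - z)) * frac_ker \<alpha> z))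
       \<longlongrightarrow> (2 * f x - f (x + z) - f (x - z)) * frac_ker \<alpha> z) at_top"
    proof (rule AE_I2)
      fix z :: 'a
      show "((\<lambda>t. indicator (- ball 0 (inverse t)) z * ((2 * f x - f (x + z) - f (x - z)) * frac_ker \<alpha> z))
         \<longlongrightarrow> (2 * f x - f (x + z) - f (x - z)) * frac_ker \<alpha> z) at_top"
      proof (cases "z = 0")
        case True then show ?thesis by (simp add: frac_ker_def)
      next
        case False
        show ?thesis
        proof (rule tendsto_eventually)
          show "\<forall>\<^sub>F t in at_top. indicator (- ball 0 (inverse t)) z * ((2 * f x - f (x + z) - f (x - z)) * frac_ker \<alpha> z)
              = (2 * f x - f (x + z) - f (x - z)) * frac_ker \<alpha> z"
            using eventually_ge_at_top[of "inverse (norm z)"]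
          proof eventually_elim
            case (elim t)
            then have "inverse t \<le> norm z" using False
              by (metis inverse_inverse_eq le_imp_inverse_le positive_imp_inverse_positive zero_less_norm_iff)
            then show ?case by (simp add: indicator_def)
          qed
        qed
      qed
    qed
    show "\<forall>\<^sub>F t in at_top. AE z in lborel.
        norm (indicator (- ball 0 (inverse t)) z * ((2 * f x - f (x + z) - f (x - z)) * frac_ker \<alpha> z))
        \<le> \<bar>(2 * f x - f (x + z) - f (x - z)) * frac_ker \<alpha> z\<bar>"
      by (intro always_eventually allI AE_I2) (auto simp: indicator_def)
  qed measurable
  then have "(?S \<longlongrightarrow> frac_lap2 \<alpha> f x) (at_right 0)"
    by (simp add: filterlim_at_right_to_top)
  then have "((\<lambda>\<epsilon>. ?S \<epsilon> / 2) \<longlongrightarrow> frac_lap2 \<alpha> f x / 2) (at_right 0)"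
    by (intro tendsto_divide tendsto_const) auto
  moreover have "\<forall>\<^sub>F \<epsilon> in at_right 0. ?S \<epsilon> / 2 = ?I \<epsilon>"
    unfolding eventually_at_right_field using I by (intro exI[of _ 1]) auto
  ultimately have "(?I \<longlongrightarrow> frac_lap2 \<alpha> f x / 2) (at_right 0)"
    by (rule Lim_transform_eventually)
  then have "Lim (at_right 0) ?I = frac_lap2 \<alpha> f x / 2" by (intro tendsto_Lim) auto
  then show ?thesis by (simp add: frac_lap_def)
qed

section \<open>Scaling, boundedness and decay of the operator on bumps\<close>

lemma frac_lap2_measurable [measurable]:
  assumes [measurable]: "f \<in> borel_measurable borel"
  shows "frac_lap2 \<alpha> f \<in> borel_measurable borel"
  unfolding frac_lap2_def[abs_def] by measurable

lemma frac_lap2_bump_scale: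
  fixes x :: "'a::euclidean_space"
  assumes "s > 0"
  shows "frac_lap2 \<alpha> (bump c s) x = s powr (- 2 * \<alpha>) * frac_lap2 \<alpha> (bump 0 1) ((1 / s) *\<^sub>R (x - c))"
proof -
  have b: "bump c s y = bump 0 1 ((1 / s) *\<^sub>R (y - c))" for y
    using bump_affine[OF assms, of c 1 "(1 / s) *\<^sub>R (y - c)"] assms by simp
  let ?y = "(1 / s) *\<^sub>R (x - c)"
  let ?F = "\<lambda>z. (2 * bump c s x - bump c s (x + z) - bump c s (x - z)) * frac_ker \<alpha> z"
  have "frac_lap2 \<alpha> (bump c s) x = s ^ DIM('a) * (LINT z|lborel. ?F (0 + s *\<^sub>R z))"
    unfolding frac_lap2_def using assms by (subst lborel_integral_affine[of s _ 0]) auto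
  also have "(\<lambda>z. ?F (0 + s *\<^sub>R z)) = (\<lambda>z. s powr (- real DIM('a) - 2 * \<alpha>) *
     ((2 * bump 0 1 ?y - bump 0 1 (?y + z) - bump 0 1 (?y - z)) * frac_ker \<alpha> z))"
    unfolding b using assms by (simp add: frac_ker_scaleR algebra_simps)
  also have "s ^ DIM('a) * (LINT z|lborel. s powr (- real DIM('a) - 2 * \<alpha>) *
     ((2 * bump 0 1 ?y - bump 0 1 (?y + z) - bump 0 1 (?y - z)) * frac_ker \<alpha> z))
    = (s powr (real DIM('a)) * s powr (- real DIM('a) - 2 * \<alpha>)) * frac_lap2 \<alpha> (bump 0 1) ?y"
    using assms by (simp add: frac_lap2_def powr_realpow)
  also have "\<dots> = s powr (- 2 * \<alpha>) * frac_lap2 \<alpha> (bump 0 1) ?y"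
    unfolding powr_add[symmetric] by simp
  finally show ?thesis .
qed

lemma frac_lap_bump:
  fixes x :: "'a::euclidean_space"
  assumes "0 < \<alpha>" "\<alpha> < 1" "s > 0"
  shows "frac_lap \<alpha> (bump c s) x = frac_const \<alpha> TYPE('a) / 2 * frac_lap2 \<alpha> (bump c s) x"
  using assms
  by (intro frac_lap_eq[where B=1 and C="1804 * max 1 (1 / s ^ 2)"] bump_second_difference)
    (auto simp: bump_le_1)

lemma frac_lap2_bump_bounded:
  assumes "0 < \<alpha>" "\<alpha> < 1" "s > 0"
  shows "\<exists>C. \<forall>c x :: 'a::euclidean_space.
    (LINT z|lborel. \<bar>(2 * bump c s x - bump c s (x + z) - bump c s (x - z)) * frac_ker \<alpha> z\<bar>) \<le> C
    \<and> \<bar>frac_lap2 \<alpha> (bump c s) x\<bar> \<le> C"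
proof -
  let ?C = "1804 * max 1 (1 / s ^ 2) * (LINT z|(lborel::'a measure). min 1 (norm z ^ 2) * frac_ker \<alpha> z)"
  have 1: "(LINT z|lborel. \<bar>(2 * bump c s x - bump c s (x + z) - bump c s (x - z)) * frac_ker \<alpha> z\<bar>) \<le> ?C"
    for c x :: 'a
    using assms by (intro frac_lap2_bound bump_second_difference) auto
  moreover have "\<bar>frac_lap2 \<alpha> (bump c s) x\<bar> \<le> ?C" for c x :: 'a
    using order_trans[OF integral_abs_bound 1[of c x]] by (simp add: frac_lap2_def)
  ultimately show ?thesis by blast
qed

text \<open>If \<open>norm x >= 2\<close>, the bump vanishes at \<open>x\<close>, and at
  \<open>x + z\<close> and \<open>x - z\<close> as long as \<open>norm z < norm x - 1\<close>. Only
  the tail of the kernel beyond that radius remains, with mass of order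
  \<open>(norm x - 1) powr (- 2 * \<alpha>)\<close>; this crude rate suffices.\<close>

lemma frac_lap2_bump_decay:
  assumes "0 < \<alpha>" "\<alpha> < 1"
  shows "(frac_lap2 \<alpha> (bump (0::'a::euclidean_space) 1) \<longlongrightarrow> 0) at_infinity"
proof -
  have bound: "\<bar>frac_lap2 \<alpha> (bump (0::'a) 1) x\<bar>
      \<le> 2 * ((norm x - 1) powr (- 2 * \<alpha>) * far_mass \<alpha> TYPE('a))" if x: "norm x \<ge> 2" for x
  proof -
    let ?F = "\<lambda>z. (2 * bump 0 1 x - bump 0 1 (x + z) - bump 0 1 (x - z)) * frac_ker \<alpha> z"
    have x1: "norm x - 1 > 0" using x by simp
    have "\<bar>frac_lap2 \<alpha> (bump 0 1) x\<bar> \<le> (LINT z|lborel. \<bar>?F z\<bar>)"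
      unfolding frac_lap2_def by (rule integral_abs_bound)
    also have "\<dots> \<le> (LINT z|(lborel::'a measure). 2 * (indicator (- ball 0 (norm x - 1)) z * frac_ker \<alpha> z))"
    proof (rule integral_mono)
      show "integrable lborel (\<lambda>z. \<bar>?F z\<bar>)"
        using assms by (intro integrable_abs frac_lap2_integrable[where C="1804 * max 1 (1 / 1 ^ 2)"]
            bump_second_difference) auto
      show "integrable lborel (\<lambda>z::'a. 2 * (indicator (- ball 0 (norm x - 1)) z * frac_ker \<alpha> z))"
        using frac_ker_far[OF assms(1) x1, where 'a='a] by (intro integrable_mult_right) (simp add: has_bochner_integral_iff)
      fix z
      have x0: "bump 0 1 x = 0" using x by (subst bump_eq_0_iff) auto
      show "\<bar>?F z\<bar> \<le> 2 * (indicator (- ball 0 (norm x - 1)) z * frac_ker \<alpha> z)"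
      proof (cases "norm z < norm x - 1")
        case True
        have "norm (x + z) \<ge> 1" "norm (x - z) \<ge> 1"
          using True norm_triangle_ineq2[of x z] norm_diff_ineq[of x z] by linarith+
        then have "bump 0 1 (x + z) = 0" "bump 0 1 (x - z) = 0"
          by (subst bump_eq_0_iff; simp)+
        with x0 show ?thesis by simp
      next
        case False
        have "\<bar>2 * bump 0 1 x - bump 0 1 (x + z) - bump 0 1 (x - z)\<bar> \<le> 2"
          using x0 bump_nonneg[of 0 1 "x + z"] bump_nonneg[of 0 1 "x - z"]
            bump_le_1[of 0 1 "x + z"] bump_le_1[of 0 1 "x - z"] by linarith
        then have "\<bar>?F z\<bar> \<le> 2 * frac_ker \<alpha> z"
          unfolding abs_mult abs_of_nonneg[OF frac_ker_nonneg] by (intro mult_right_mono) auto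
        with False show ?thesis by (simp add: indicator_def)
      qed
    qed
    also have "\<dots> = 2 * ((norm x - 1) powr (- 2 * \<alpha>) * far_mass \<alpha> TYPE('a))"
      using frac_ker_far[OF assms(1) x1, where 'a='a] by (simp add: has_bochner_integral_iff)
    finally show ?thesis .
  qed
  have "((\<lambda>x::'a. (norm x - 1) powr (- 2 * \<alpha>)) \<longlongrightarrow> 0) at_infinity"
  proof (rule tendsto_neg_powr)
    show "filterlim (\<lambda>x::'a. norm x - 1) at_top at_infinity"
      using filterlim_tendsto_add_at_top[OF tendsto_const[of "-1"] filterlim_norm_at_top] by simp
  qed (use assms in simp)
  then have "((\<lambda>x::'a. 2 * ((norm x - 1) powr (- 2 * \<alpha>) * far_mass \<alpha> TYPE('a))) \<longlongrightarrow> 0) at_infinity"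
    by (intro tendsto_mult_right_zero tendsto_mult_left_zero)
  then show ?thesis
    by (rule Lim_null_comparison[rotated])
      (use bound in \<open>auto simp: eventually_at_infinity intro!: exI[of _ 2]\<close>)
qed

section \<open>A sup bound for subsolutions\<close>

lemma inverse_power_one_minus_le:
  "\<exists>C\<ge>0. \<forall>y::real. \<bar>y\<bar> \<le> 1 / 2 \<longrightarrow> 1 / (1 - y) ^ n \<le> 1 + real n * y + C * y ^ 2"
proof (induction n)
  case 0
  show ?case by (intro exI[of _ 0]) auto
next
  case (Suc n)
  then obtain C where C: "C \<ge> 0" "\<And>y. \<bar>y\<bar> \<le> 1 / 2 \<Longrightarrow> 1 / (1 - y) ^ n \<le> 1 + real n * y + C * y ^ 2"
    by blast
  \<comment> \<open>In the product of the two quadratic bounds the coefficients of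
    \<open>y ^ 2\<close>, \<open>y ^ 3\<close> and \<open>y ^ 4\<close> are
    \<open>n + C + 2\<close>, \<open>C + 2 * n\<close> and \<open>2 * C\<close>. Since
    \<open>y\<close> is at most 1 in absolute value, their sum bounds the whole remainder.\<close>
  let ?D = "real n + C + 2 + (C + 2 * real n) + 2 * C"
  show ?case
  proof (intro exI[of _ ?D] conjI allI impI)
    show "?D \<ge> 0" using C(1) by simp
    fix y :: real assume y: "\<bar>y\<bar> \<le> 1 / 2"
    have "1 / (1 - y) = 1 + y + y ^ 2 * (1 / (1 - y))" using y by (simp add: field_simps power2_eq_square)
    also have "\<dots> \<le> 1 + y + y ^ 2 * 2"
      using y by (intro add_left_mono mult_left_mono) (auto simp: field_simps)
    finally have 1: "1 / (1 - y) \<le> 1 + y + 2 * y ^ 2" by simp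
    have "1 / (1 - y) ^ Suc n = 1 / (1 - y) ^ n * (1 / (1 - y))" by simp
    also have "\<dots> \<le> (1 + real n * y + C * y ^ 2) * (1 + y + 2 * y ^ 2)"
    proof (rule mult_mono[OF C(2)[OF y] 1])
      show "0 \<le> 1 / (1 - y)" using y by simp
      have "0 \<le> 1 / (1 - y) ^ n" using y by simp
      also note C(2)[OF y]
      finally show "0 \<le> 1 + real n * y + C * y ^ 2" .
    qed
    also have "\<dots> = 1 + real (Suc n) * y + (real n + C + 2 + y * (C + 2 * real n) + y ^ 2 * (2 * C)) * y ^ 2"
      by (simp add: algebra_simps power2_eq_square)
    also have "\<dots> \<le> 1 + real (Suc n) * y + ?D * y ^ 2"
    proof -
      have "y * (C + 2 * real n) \<le> 1 * (C + 2 * real n)" using y C(1) by (intro mult_right_mono) auto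
      moreover have "y ^ 2 * (2 * C) \<le> 1 * (2 * C)"
        using y C(1) abs_square_le_1[of y] by (intro mult_right_mono) auto
      ultimately show ?thesis by (intro add_left_mono mult_right_mono) auto
    qed
    finally show "1 / (1 - y) ^ Suc n \<le> 1 + real (Suc n) * y + ?D * y ^ 2" .
  qed
qed

text \<open>The terms linear in \<open>a\<close> cancel in the sum. In the application
  \<open>a\<close> is of first and \<open>b\<close> of second order in the increment, so the error
  is quadratic.\<close>

lemma inverse_power_symmetric_sum_le:
  "\<exists>C\<ge>0. \<forall>a b::real. \<bar>a\<bar> \<le> 1 / 4 \<and> 0 \<le> b \<and> b \<le> 1 / 4 \<longrightarrow>
     1 / (1 - a - b) ^ n + 1 / (1 + a - b) ^ n \<le> 2 + C * (a ^ 2 + b)"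
proof -
  obtain C where C: "C \<ge> 0" "\<And>y. \<bar>y\<bar> \<le> 1 / 2 \<Longrightarrow> 1 / (1 - y) ^ n \<le> 1 + real n * y + C * y ^ 2"
    using inverse_power_one_minus_le by blast
  show ?thesis
  proof (intro exI[of _ "2 * real n + 2 * C"] conjI allI impI)
    show "0 \<le> 2 * real n + 2 * C" using C(1) by simp
    fix a b :: real assume ab: "\<bar>a\<bar> \<le> 1 / 4 \<and> 0 \<le> b \<and> b \<le> 1 / 4"
    have "1 / (1 - (a + b)) ^ n + 1 / (1 - (b - a)) ^ n
      \<le> (1 + real n * (a + b) + C * (a + b) ^ 2) + (1 + real n * (b - a) + C * (b - a) ^ 2)"
      using ab by (intro add_mono C(2)) linarith+
    also have "\<dots> = 2 + (2 * real n) * b + (2 * C) * (a ^ 2 + b * b)"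
      by (simp add: algebra_simps power2_eq_square)
    also have "\<dots> \<le> 2 + (2 * real n) * (a ^ 2 + b) + (2 * C) * (a ^ 2 + b)"
      using ab C(1) by (intro add_mono mult_left_mono order_refl) (auto simp: mult_left_le)
    also have "\<dots> = 2 + (2 * real n + 2 * C) * (a ^ 2 + b)" by (simp add: algebra_simps)
    finally show "1 / (1 - a - b) ^ n + 1 / (1 + a - b) ^ n \<le> 2 + (2 * real n + 2 * C) * (a ^ 2 + b)"
      by (simp add: algebra_simps)
  qed
qed

text \<open>The weight \<^term>\<open>(R ^ 2 - norm (x - x0) ^ 2) ^ n\<close> forces a maximum point into the interior;
  there the function lies below a multiple of the inverse weight, whose second differences are
  controlled.\<close>

lemma second_difference_at_weighted_max:
  assumes C: "\<And>a b::real. \<bar>a\<bar> \<le> 1 / 4 \<Longrightarrow> 0 \<le> b \<Longrightarrow> b \<le> 1 / 4 \<Longrightarrow>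
     1 / (1 - a - b) ^ n + 1 / (1 + a - b) ^ n \<le> 2 + C * (a ^ 2 + b)" and "C \<ge> 0"
    and R: "R > 0" and x1: "x1 \<in> ball x0 R" and w0: "w x1 \<ge> 0"
    and max: "\<And>x. x \<in> ball x0 R \<Longrightarrow>
      w x * (R ^ 2 - norm (x - x0) ^ 2) ^ n \<le> w x1 * (R ^ 2 - norm (x1 - x0) ^ 2) ^ n"
    and \<theta>: "0 < \<theta>" "\<theta> \<le> 1 / 8" and s: "s = \<theta> * (R ^ 2 - norm (x1 - x0) ^ 2) / R"
    and z: "norm z < s"
  shows "2 * w x1 - w (x1 + z) - w (x1 - z) \<ge> - (5 * C * \<theta> ^ 2 * w x1 / s ^ 2) * norm (z::'a::euclidean_space) ^ 2"
proof -
  define t where "t = R ^ 2 - norm (x1 - x0) ^ 2"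
  have tR: "t \<le> R ^ 2" by (simp add: t_def)
  have t: "t > 0"
    using x1 R power_strict_mono[of "norm (x1 - x0)" R 2] by (simp add: t_def dist_norm norm_minus_commute)
  have sR: "s * R = \<theta> * t" using R by (simp add: s t_def)
  have s0: "s > 0" using R \<theta> t by (simp add: s t_def[symmetric])
  \<comment> \<open>With these, the base of the weight at \<open>x1 + z\<close> is
    \<open>t * (1 - a - b)\<close> and at \<open>x1 - z\<close> it is
    \<open>t * (1 + a - b)\<close>.\<close>
  define a where "a = 2 * ((x1 - x0) \<bullet> z) / t"
  define b where "b = norm z ^ 2 / t"
  have ta: "t * a = 2 * ((x1 - x0) \<bullet> z)" and tb: "t * b = norm z ^ 2"
    using t by (simp_all add: a_def b_def)
  have a1: "\<bar>a\<bar> \<le> 2 * R * norm z / t"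
  proof -
    have "\<bar>(x1 - x0) \<bullet> z\<bar> \<le> norm (x1 - x0) * norm z" by (rule Cauchy_Schwarz_ineq2)
    also have "\<dots> \<le> R * norm z"
      using x1 by (intro mult_right_mono) (auto simp: dist_norm norm_minus_commute)
    finally show ?thesis using t by (simp add: a_def abs_mult divide_right_mono)
  qed
  also have "\<dots> \<le> 2 * R * s / t"
    using z R t by (intro divide_right_mono mult_left_mono) auto
  also have "\<dots> = 2 * \<theta>" using sR t by (simp add: field_simps)
  finally have a2: "\<bar>a\<bar> \<le> 1 / 4" using \<theta> by simp
  have b0: "b \<ge> 0" using t by (simp add: b_def)
  have b1: "b \<le> R ^ 2 * norm z ^ 2 / t ^ 2"
  proof -
    have "b = t * norm z ^ 2 / t ^ 2" using t by (simp add: b_def power2_eq_square)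
    also have "\<dots> \<le> R ^ 2 * norm z ^ 2 / t ^ 2" using tR by (intro divide_right_mono mult_right_mono) auto
    finally show ?thesis .
  qed
  \<comment> \<open>This identity, from \<open>s * R = \<theta> * t\<close>, turns bounds relative
    to \<open>t\<close> into the factor \<open>\<theta> ^ 2\<close>, which can be made
    small.\<close>
  have Rs: "R ^ 2 / t ^ 2 = \<theta> ^ 2 / s ^ 2"
  proof -
    have "(s * R) ^ 2 = (\<theta> * t) ^ 2" using sR by simp
    then show ?thesis using s0 t by (simp add: field_simps power_mult_distrib)
  qed
  have a3: "a ^ 2 \<le> 4 * (R ^ 2 * norm z ^ 2 / t ^ 2)"
    using power_mono[OF a1, of 2] by (simp add: power_divide power_mult_distrib)
  have b2: "b \<le> 1 / 4"
  proof -
    have "R ^ 2 * norm z ^ 2 / t ^ 2 = (\<theta> ^ 2 / s ^ 2) * norm z ^ 2" unfolding Rs[symmetric] by simp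
    also have "\<dots> \<le> (\<theta> ^ 2 / s ^ 2) * s ^ 2" using z by (intro mult_left_mono power_mono) auto
    also have "\<dots> = \<theta> ^ 2" using s0 by simp
    also have "\<dots> \<le> (1 / 8) ^ 2" using \<theta> by (intro power_mono) auto
    also have "(1 / 8 :: real) ^ 2 \<le> 1 / 4" by (simp add: power2_eq_square)
    finally show ?thesis using b1 by (rule order_trans[rotated])
  qed
  \<comment> \<open>Positive weight places \<open>x\<close> in the ball, so maximality applies and
    the weights \<open>(t * y) ^ n\<close> and \<open>t ^ n\<close> can be compared.\<close>
  have bound: "w x \<le> w x1 * (1 / y ^ n)" if e: "R ^ 2 - norm (x - x0) ^ 2 = t * y" and y: "y > 0" for x y
  proof -
    have p: "t * y > 0" using t y by simp
    then have "norm (x - x0) ^ 2 < R ^ 2" using e by simp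
    then have "x \<in> ball x0 R" using R power2_less_imp_less[of "norm (x - x0)" R]
      by (simp add: dist_norm norm_minus_commute)
    from max[OF this] have "w x * (t * y) ^ n \<le> w x1 * t ^ n" by (simp add: e t_def[symmetric])
    then have "(w x * y ^ n) * t ^ n \<le> w x1 * t ^ n" by (simp add: power_mult_distrib algebra_simps)
    then have "w x * y ^ n \<le> w x1" using t by (simp add: mult_le_cancel_right)
    then show ?thesis using y by (simp add: field_simps)
  qed
  have "w (x1 + z) \<le> w x1 * (1 / (1 - a - b) ^ n)"
  proof (rule bound)
    have "norm (x1 + z - x0) ^ 2 = norm (x1 - x0) ^ 2 + 2 * ((x1 - x0) \<bullet> z) + norm z ^ 2"
      unfolding power2_norm_eq_inner by (simp add: algebra_simps inner_commute)
    then show "R\<^sup>2 - (norm (x1 + z - x0))\<^sup>2 = t * (1 - a - b)"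
      unfolding right_diff_distrib distrib_left ta tb by (simp add: t_def)
    show "1 - a - b > 0" using a2 b2 by linarith
  qed
  moreover have "w (x1 - z) \<le> w x1 * (1 / (1 + a - b) ^ n)"
  proof (rule bound)
    have "norm (x1 - z - x0) ^ 2 = norm (x1 - x0) ^ 2 - 2 * ((x1 - x0) \<bullet> z) + norm z ^ 2"
      unfolding power2_norm_eq_inner by (simp add: algebra_simps inner_commute)
    then show "R\<^sup>2 - (norm (x1 - z - x0))\<^sup>2 = t * (1 + a - b)"
      unfolding right_diff_distrib distrib_left ta tb by (simp add: t_def)
    show "1 + a - b > 0" using a2 b2 by linarith
  qed
  ultimately have "w (x1 + z) + w (x1 - z) \<le> w x1 * (1 / (1 - a - b) ^ n + 1 / (1 + a - b) ^ n)"
    unfolding distrib_left by linarith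
  also have "\<dots> \<le> w x1 * (2 + C * (a ^ 2 + b))"
    using C[OF a2 b0 b2] w0 by (intro mult_left_mono)
  \<comment> \<open>The 5 is 4 from \<open>a ^ 2\<close> plus 1 from \<open>b\<close>.\<close>
  also have "\<dots> \<le> w x1 * (2 + C * (5 * (R ^ 2 * norm z ^ 2 / t ^ 2)))"
    using a3 b1 \<open>C \<ge> 0\<close> w0 by (intro mult_left_mono add_left_mono) auto
  also have "R ^ 2 * norm z ^ 2 / t ^ 2 = (R ^ 2 / t ^ 2) * norm z ^ 2" by simp
  finally show ?thesis unfolding Rs by (simp add: algebra_simps)
qed

text \<open>Let \<open>x1\<close> maximise \<open>w x * T x ^ N\<close>, where
  \<open>N = DIM('a)\<close> and \<open>T x = R ^ 2 - norm (x - x0) ^ 2\<close>, and split the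
  integral at \<open>x1\<close> at a radius \<open>s\<close> proportional to
  \<open>T x1 / R\<close>. The near part loses a small multiple of
  \<open>w x1 * s powr (- 2 * \<alpha>)\<close>; the far part gains a fixed multiple of it and loses
  at most \<open>2 * m * s powr (- N - 2 * \<alpha>)\<close>. Multiplication by
  \<open>s powr (N + 2 * \<alpha>)\<close> bounds \<open>w x1 * s ^ N\<close>. This is why the
  weight has exponent \<open>N\<close>: up to \<open>\<theta>\<close> and \<open>R\<close> the
  bounded quantity is the maximal value, which is at least
  \<open>w x0 * (R ^ 2) ^ N\<close>.\<close>

lemma sup_bound_frac_subsolution:
  assumes \<alpha>: "0 < \<alpha>" "\<alpha> < 1"
  shows "\<exists>C>0. \<forall>(w :: 'a::euclidean_space \<Rightarrow> real) x0 R m K.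
    R > 0 \<longrightarrow> K \<ge> 0 \<longrightarrow> continuous_on UNIV w \<longrightarrow> (\<forall>x. w x \<ge> 0) \<longrightarrow> integrable lborel w \<longrightarrow>
    integral\<^sup>L lborel w \<le> m \<longrightarrow>
    (\<forall>x\<in>ball x0 R. integrable lborel (\<lambda>z. (2 * w x - w (x + z) - w (x - z)) * frac_ker \<alpha> z) \<and>
       frac_lap2 \<alpha> w x \<le> K) \<longrightarrow>
    w x0 \<le> C * (K * R powr (2 * \<alpha>) + m / R ^ DIM('a))"
proof -
  let ?n = "DIM('a)"
  define I where "I = near_mass \<alpha> TYPE('a)"
  define J where "J = far_mass \<alpha> TYPE('a)"
  have I0: "I \<ge> 0" unfolding I_def by (rule near_mass_nonneg)
  have J0: "J > 0" unfolding J_def by (rule far_mass_pos[OF \<alpha>(1)])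
  obtain C0 where C0: "C0 \<ge> 0" "\<And>a b::real. \<bar>a\<bar> \<le> 1 / 4 \<Longrightarrow> 0 \<le> b \<Longrightarrow> b \<le> 1 / 4 \<Longrightarrow>
     1 / (1 - a - b) ^ ?n + 1 / (1 + a - b) ^ ?n \<le> 2 + C0 * (a ^ 2 + b)"
    using inverse_power_symmetric_sum_le[of ?n] by blast
  \<comment> \<open>\<open>1 / 8\<close> is required by
    \<open>second_difference_at_weighted_max\<close>; the other bound keeps the near loss below
    \<open>J\<close>. The added 1 prevents division by 0.\<close>
  define \<theta> where "\<theta> = min (1 / 8) (J / (5 * C0 * I + 1))"
  have pos: "5 * C0 * I + 1 > 0" using C0(1) I0 by (simp add: add_nonneg_pos)
  have \<theta>: "0 < \<theta>" "\<theta> \<le> 1 / 8"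
    using J0 pos unfolding \<theta>_def by (simp, intro min.cobounded1)
  have \<theta>J: "5 * C0 * \<theta> ^ 2 * I \<le> J"
  proof -
    have "5 * C0 * \<theta> ^ 2 * I = (5 * C0 * I * \<theta>) * \<theta>" by (simp add: power2_eq_square)
    also have "\<dots> \<le> (5 * C0 * I * \<theta>) * 1"
      using \<theta> C0(1) I0 by (intro mult_left_mono) auto
    also have "\<dots> \<le> (5 * C0 * I + 1) * \<theta>" using \<theta> by (simp add: algebra_simps)
    also have "\<dots> \<le> (5 * C0 * I + 1) * (J / (5 * C0 * I + 1))"
      using pos by (intro mult_left_mono) (auto simp: \<theta>_def)
    also have "\<dots> = J" using pos by simp
    finally show ?thesis .
  qed
  define C where "C = 2 / (J * \<theta> ^ ?n)"
  have C: "C > 0" using J0 \<theta> by (simp add: C_def)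
  show ?thesis
  proof (intro exI[of _ C] conjI allI impI C)
    fix w :: "'a \<Rightarrow> real" and x0 :: 'a and R m K :: real
    assume R: "R > 0" and K: "K \<ge> 0" and cont: "continuous_on UNIV w" and w0: "\<forall>x. w x \<ge> 0"
      and int: "integrable lborel w" and m: "integral\<^sup>L lborel w \<le> m"
      and lap: "\<forall>x\<in>ball x0 R. integrable lborel (\<lambda>z. (2 * w x - w (x + z) - w (x - z)) * frac_ker \<alpha> z) \<and>
       frac_lap2 \<alpha> w x \<le> K"
    have m0: "m \<ge> 0" using w0 by (intro order_trans[OF Bochner_Integration.integral_nonneg m]) simp
    define T where "T x = R ^ 2 - norm (x - x0) ^ 2" for x
    have "continuous_on (cball x0 R) (\<lambda>x. w x * T x ^ ?n)"
      unfolding T_def by (intro continuous_intros continuous_on_subset[OF cont]) auto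
    then obtain x1 where x1: "x1 \<in> cball x0 R" "\<And>x. x \<in> cball x0 R \<Longrightarrow> w x * T x ^ ?n \<le> w x1 * T x1 ^ ?n"
      using continuous_attains_sup[of "cball x0 R" "\<lambda>x. w x * T x ^ ?n"] R by auto
    have x0: "w x0 * (R ^ 2) ^ ?n \<le> w x1 * T x1 ^ ?n" using x1(2)[of x0] R by (simp add: T_def)
    show "w x0 \<le> C * (K * R powr (2 * \<alpha>) + m / R ^ ?n)"
    proof (cases "x1 \<in> ball x0 R")
      \<comment> \<open>On the sphere the weight is 0, so the maximal value is 0 and
        \<open>w x0\<close> vanishes.\<close>
      case False
      then have "T x1 = 0" using x1(1) by (simp add: T_def dist_norm norm_minus_commute)
      then have "w x0 * (R ^ 2) ^ ?n \<le> 0" using x0 by (simp add: zero_power)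
      moreover have "(R ^ 2) ^ ?n > 0" using R by simp
      ultimately have "w x0 \<le> 0" by (auto simp: mult_le_0_iff)
      also have "0 \<le> C * (K * R powr (2 * \<alpha>) + m / R ^ ?n)" using C K m0 R by simp
      finally show ?thesis .
    next
      case True
      define t where "t = T x1"
      have tR: "t \<le> R ^ 2" by (simp add: t_def T_def)
      have t: "t > 0"
        using True R power_strict_mono[of "norm (x1 - x0)" R 2]
        by (simp add: t_def T_def dist_norm norm_minus_commute)
      define s where "s = \<theta> * t / R"
      have s0: "s > 0" using R \<theta> t by (simp add: s_def)
      have sR: "s \<le> R"
      proof -
        have "\<theta> * t \<le> 1 * R ^ 2" using \<theta> tR t by (intro mult_mono) auto
        then show ?thesis using R by (simp add: s_def field_simps power2_eq_square)
      qed
      define w1 where "w1 = w x1"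
      have w1: "w1 \<ge> 0" using w0 by (simp add: w1_def)
      define q where "q = 5 * C0 * \<theta> ^ 2 * w1 / s ^ 2"
      let ?F = "\<lambda>z. (2 * w x1 - w (x1 + z) - w (x1 - z)) * frac_ker \<alpha> z"
      let ?N = "\<lambda>z::'a. indicator (ball 0 s) z * (norm z ^ 2 * frac_ker \<alpha> z)"
      let ?Fa = "\<lambda>z::'a. indicator (- ball 0 s) z * frac_ker \<alpha> z"
      let ?k = "s powr (- real ?n - 2 * \<alpha>)"
      \<comment> \<open>Pointwise lower bound for the integrand. The two translates of
        \<open>w\<close> are subtracted for all \<open>z\<close>, not only far ones, so that their
        integrals are the full mass.\<close>
      let ?L = "\<lambda>z. (2 * w1) * ?Fa z - q * ?N z - ?k * (w (x1 + 1 *\<^sub>R z) + w (x1 + (- 1) *\<^sub>R z))"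
      have N: "integrable lborel ?N" "integral\<^sup>L lborel ?N = s powr (2 - 2 * \<alpha>) * I"
        using frac_ker_near[OF \<alpha> s0, where 'a='a] by (simp_all add: has_bochner_integral_iff I_def)
      have Fa: "integrable lborel ?Fa" "integral\<^sup>L lborel ?Fa = s powr (- 2 * \<alpha>) * J"
        using frac_ker_far[OF \<alpha>(1) s0, where 'a='a] by (simp_all add: has_bochner_integral_iff J_def)
      have W: "integrable lborel (\<lambda>z. w (x1 + c *\<^sub>R z))" "(LINT z|lborel. w (x1 + c *\<^sub>R z)) = integral\<^sup>L lborel w"
        if "\<bar>c\<bar> = 1" for c
      proof -
        have "c \<noteq> 0" using that by auto
        then show "integrable lborel (\<lambda>z. w (x1 + c *\<^sub>R z))" using int by (rule lborel_integrable_affine)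
        show "(LINT z|lborel. w (x1 + c *\<^sub>R z)) = integral\<^sup>L lborel w"
          using lborel_integral_affine[OF \<open>c \<noteq> 0\<close>, of w x1] that by simp
      qed
      note W1 = W[of 1, simplified abs_one, OF refl] and W2 = W[of "- 1", simplified abs_minus_cancel abs_one, OF refl]
      have L: "integrable lborel ?L"
        by (intro Bochner_Integration.integrable_diff Bochner_Integration.integrable_add integrable_mult_right Fa N W1 W2)
      have "(2 * w1) * (s powr (- 2 * \<alpha>) * J) - q * (s powr (2 - 2 * \<alpha>) * I) - ?k * (2 * integral\<^sup>L lborel w)
          = integral\<^sup>L lborel ?L"
        by (subst Bochner_Integration.integral_diff Bochner_Integration.integral_add integral_mult_right_zero;
          (intro Bochner_Integration.integrable_diff Bochner_Integration.integrable_add integrable_mult_right Fa N W1 W2)?)+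
          (simp only: Fa N W1 W2 mult_2)
      also have "\<dots> \<le> integral\<^sup>L lborel ?F"
      proof (rule integral_mono[OF L])
        show "integrable lborel ?F" using lap True by blast
        fix z :: 'a
        show "?L z \<le> ?F z"
        proof (cases "norm z < s")
          case z: True
          have "- q * norm z ^ 2 \<le> 2 * w x1 - w (x1 + z) - w (x1 - z)"
            unfolding q_def w1_def
            by (rule second_difference_at_weighted_max[where n="?n" and C=C0 and R=R and ?x0.0=x0 and \<theta>=\<theta> and s=s])
              (use C0 R True w0 x1(2) \<theta> z in \<open>auto simp: T_def s_def t_def\<close>)
          then have "(- q * norm z ^ 2) * frac_ker \<alpha> z \<le> ?F z" by (rule mult_right_mono) simp
          moreover have "0 \<le> ?k * (w (x1 + 1 *\<^sub>R z) + w (x1 + (- 1) *\<^sub>R z))" using w0 by simp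
          moreover have "indicator (ball 0 s) z = (1::real)" "indicator (- ball 0 s) z = (0::real)"
            using z by (simp_all add: indicator_def)
          ultimately show ?thesis by (simp add: algebra_simps)
        next
          case z: False
          have "frac_ker \<alpha> z \<le> ?k" using z s0 \<alpha> by (intro frac_ker_antimono) auto
          then have "(w (x1 + z) + w (x1 - z)) * frac_ker \<alpha> z \<le> (w (x1 + z) + w (x1 - z)) * ?k"
            using w0 by (intro mult_left_mono) auto
          moreover have "indicator (ball 0 s) z = (0::real)" "indicator (- ball 0 s) z = (1::real)"
            using z by (simp_all add: indicator_def)
          ultimately show ?thesis by (simp add: algebra_simps w1_def)
        qed
      qed
      also have "\<dots> \<le> K" using lap True by (auto simp: frac_lap2_def)
      finally have main: "(2 * w1) * (s powr (- 2 * \<alpha>) * J) - q * (s powr (2 - 2 * \<alpha>) * I)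
        - ?k * (2 * integral\<^sup>L lborel w) \<le> K" .
      have "q * (s powr (2 - 2 * \<alpha>) * I) = w1 * s powr (- 2 * \<alpha>) * (5 * C0 * \<theta> ^ 2 * I)"
      proof -
        have "s powr (2 - 2 * \<alpha>) = s ^ 2 * s powr (- 2 * \<alpha>)"
          using powr_add[of s 2 "- 2 * \<alpha>"] s0 by simp
        then show ?thesis using s0 by (simp add: q_def)
      qed
      \<comment> \<open>The near loss uses up one of the two copies of the \<open>J\<close> term;
        the other one gives the estimate.\<close>
      also have "\<dots> \<le> w1 * s powr (- 2 * \<alpha>) * J" using w1 by (intro mult_left_mono \<theta>J) auto
      finally have "w1 * s powr (- 2 * \<alpha>) * J \<le> K + ?k * (2 * m)"
        using main mult_left_mono[OF m, of "2 * ?k"] by (simp add: algebra_simps)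
      then have "(w1 * s powr (- 2 * \<alpha>) * J) * (s powr (2 * \<alpha>) * s ^ ?n)
          \<le> (K + ?k * (2 * m)) * (s powr (2 * \<alpha>) * s ^ ?n)"
        using s0 by (intro mult_right_mono) auto
      moreover have "(w1 * s powr (- 2 * \<alpha>) * J) * (s powr (2 * \<alpha>) * s ^ ?n) = w1 * J * s ^ ?n"
        using s0 by (simp add: powr_minus)
      moreover have "(K + ?k * (2 * m)) * (s powr (2 * \<alpha>) * s ^ ?n) = K * (s powr (2 * \<alpha>) * s ^ ?n) + 2 * m"
      proof -
        have "?k * (s powr (2 * \<alpha>) * s powr real ?n) = 1"
          unfolding powr_add[symmetric] using s0 by simp
        then have "?k * (s powr (2 * \<alpha>) * s ^ ?n) = 1" using s0 by (simp add: powr_realpow)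
        then show ?thesis by (simp add: algebra_simps)
      qed
      ultimately have "w1 * J * s ^ ?n \<le> K * (s powr (2 * \<alpha>) * s ^ ?n) + 2 * m" by linarith
      also have "\<dots> \<le> K * (R powr (2 * \<alpha>) * R ^ ?n) + 2 * m"
        using K s0 sR \<alpha> by (intro add_right_mono mult_left_mono mult_mono powr_mono2 power_mono) auto
      also have "\<dots> \<le> 2 * (K * (R powr (2 * \<alpha>) * R ^ ?n) + m)" using K R by simp
      finally have "w1 * J * s ^ ?n \<le> 2 * (K * (R powr (2 * \<alpha>) * R ^ ?n) + m)" .
      moreover have "s ^ ?n * R ^ ?n = \<theta> ^ ?n * t ^ ?n"
        using R by (simp add: s_def power_mult_distrib[symmetric])
      ultimately have "(w1 * t ^ ?n) * (J * \<theta> ^ ?n) \<le> 2 * (K * (R powr (2 * \<alpha>) * R ^ ?n) + m) * R ^ ?n"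
        using R mult_right_mono[of "w1 * J * s ^ ?n" "2 * (K * (R powr (2 * \<alpha>) * R ^ ?n) + m)" "R ^ ?n"]
        by (simp add: algebra_simps)
      then have "w1 * t ^ ?n \<le> 2 * (K * (R powr (2 * \<alpha>) * R ^ ?n) + m) * R ^ ?n / (J * \<theta> ^ ?n)"
        using J0 \<theta> by (subst pos_le_divide_eq) auto
      also have "\<dots> = C * ((K * (R powr (2 * \<alpha>) * R ^ ?n) + m) * R ^ ?n)"
        by (simp add: C_def)
      also have "\<dots> = C * (K * R powr (2 * \<alpha>) + m / R ^ ?n) * (R ^ 2) ^ ?n"
        using R by (simp add: field_simps power_mult[symmetric] power2_eq_square power_mult_distrib)
      finally have "w x0 * (R ^ 2) ^ ?n \<le> C * (K * R powr (2 * \<alpha>) + m / R ^ ?n) * (R ^ 2) ^ ?n"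
        using x0 by (simp add: w1_def t_def)
      then show ?thesis using R by (simp add: mult_le_cancel_right)
    qed
  qed
qed

section \<open>Mollification\<close>

text \<open>A bound on the mass of \<open>k y\<close> that is uniform in \<open>y\<close> reduces
  integrability of the product to that of \<open>v\<close>. Used for the mollified mass and for the
  mollified operator.\<close>

lemma integrable_mult_kernel:
  fixes v :: "'a::euclidean_space \<Rightarrow> real" and k :: "'a \<Rightarrow> 'a \<Rightarrow> real"
  assumes v: "integrable lborel v"
    and k[measurable]: "case_prod k \<in> borel_measurable (borel \<Otimes>\<^sub>M borel)"
    and k_int: "\<And>y. integrable lborel (k y)" and k_bd: "\<And>y. (LINT z|lborel. \<bar>k y z\<bar>) \<le> C"
  shows "integrable (lborel \<Otimes>\<^sub>M lborel) (\<lambda>(y, z). v y * k y z)"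
proof (rule lborel_pair.Fubini_integrable)
  have [measurable]: "v \<in> borel_measurable borel" using borel_measurable_integrable[OF v] by simp
  show "(\<lambda>(y, z). v y * k y z) \<in> borel_measurable (lborel \<Otimes>\<^sub>M lborel)" by measurable
  have e: "(LINT z|lborel. norm (case (y, z) of (y, z) \<Rightarrow> v y * k y z)) = \<bar>v y\<bar> * (LINT z|lborel. \<bar>k y z\<bar>)" for y
    by (simp add: abs_mult)
  show "integrable lborel (\<lambda>y. LINT z|lborel. norm (case (y, z) of (y, z) \<Rightarrow> v y * k y z))"
    unfolding e
  proof (rule Bochner_Integration.integrable_bound)
    show "integrable lborel (\<lambda>y. \<bar>v y\<bar> * C)" using v by (intro integrable_mult_left integrable_abs)
    show "(\<lambda>y. \<bar>v y\<bar> * (LINT z|lborel. \<bar>k y z\<bar>)) \<in> borel_measurable lborel" by measurable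
    show "AE y in lborel. norm (\<bar>v y\<bar> * (LINT z|lborel. \<bar>k y z\<bar>)) \<le> norm (\<bar>v y\<bar> * C)"
    proof (rule AE_I2)
      fix y
      have "0 \<le> (LINT z|lborel. \<bar>k y z\<bar>)" by (rule Bochner_Integration.integral_nonneg) simp
      then have "\<bar>LINT z|lborel. \<bar>k y z\<bar>\<bar> \<le> \<bar>C\<bar>" using k_bd[of y] by linarith
      then show "norm (\<bar>v y\<bar> * (LINT z|lborel. \<bar>k y z\<bar>)) \<le> norm (\<bar>v y\<bar> * C)"
        unfolding real_norm_def abs_mult by (intro mult_left_mono) auto
    qed
  qed
  show "AE y in lborel. integrable lborel (\<lambda>z. case (y, z) of (y, z) \<Rightarrow> v y * k y z)"
    using k_int by (auto intro!: AE_I2 integrable_mult_right)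
qed

section \<open>The unnormalised bump as a mollifier\<close>

lemma bump_measurable2 [measurable (raw)]:
  fixes f g :: "'b \<Rightarrow> 'a::euclidean_space"
  assumes [measurable]: "f \<in> borel_measurable M" "g \<in> borel_measurable M"
  shows "(\<lambda>x. bump (f x) s (g x)) \<in> borel_measurable M"
proof -
  have "(\<lambda>x. bump (f x) s (g x)) = (\<lambda>x. bump 0 s (g x - f x))" by (simp add: bump_def)
  then show ?thesis by simp
qed

definition bump_mass :: "'a::euclidean_space itself \<Rightarrow> real \<Rightarrow> real" where
  "bump_mass TYPE('a) s = (LINT x|lborel. bump (0::'a) s x)"

lemma integrable_bump:
  assumes "s > 0"
  shows "integrable lborel (bump (c::'a::euclidean_space) s)"
proof (rule Bochner_Integration.integrable_bound)
  show "integrable lborel (indicator (ball c s) :: 'a \<Rightarrow> real)"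
    by (rule integrable_real_indicator) (use emeasure_lborel_ball_finite[of c s] in simp_all)
  show "AE x in lborel. norm (bump c s x) \<le> norm (indicator (ball c s) x :: real)"
  proof (rule AE_I2)
    fix x show "norm (bump c s x) \<le> norm (indicator (ball c s) x :: real)"
      using bump_eq_0_iff[OF assms, of c x] bump_le_1[of c s x] by (cases "x \<in> ball c s") auto
  qed
qed measurable

lemma integral_bump: "(LINT x|lborel. bump (c::'a::euclidean_space) s x) = bump_mass TYPE('a) s"
  unfolding bump_mass_def
  by (subst lborel_integral_affine[of 1 _ c]) (auto simp: bump_def intro!: Bochner_Integration.integral_cong)

lemma bump_mass_scale:
  assumes "s > 0"
  shows "bump_mass TYPE('a::euclidean_space) s = s ^ DIM('a) * bump_mass TYPE('a) 1"
  unfolding bump_mass_def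
  using assms bump_affine[OF assms, of "0::'a" 1]
  by (subst lborel_integral_affine[of s _ 0]) auto

lemma bump_mass_pos:
  assumes "s > 0"
  shows "0 < bump_mass TYPE('a::euclidean_space) s"
proof -
  have "bump_mass TYPE('a) s \<noteq> 0"
  proof
    assume "bump_mass TYPE('a) s = 0"
    then have "AE x in lborel. bump (0::'a) s x = 0"
      unfolding bump_mass_def using integral_nonneg_eq_0_iff_AE[OF integrable_bump[OF assms, of "0::'a"]] by simp
    then have "AE x in lborel. x \<notin> ball (0::'a) s" by (simp only: bump_eq_0_iff[OF assms])
    then have "emeasure lborel (ball (0::'a) s) = 0"
      by (subst (asm) AE_iff_measurable[of "ball 0 s"]) auto
    then have "measure lborel (ball (0::'a) s) = 0" by (simp add: measure_def)
    with content_ball_pos[OF assms, of "0::'a"] show False by simp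
  qed
  moreover have "bump_mass TYPE('a) s \<ge> 0"
    unfolding bump_mass_def by (intro Bochner_Integration.integral_nonneg) simp
  ultimately show ?thesis by simp
qed

lemma integrable_mult_bump:
  fixes v :: "'a::euclidean_space \<Rightarrow> real"
  assumes v: "integrable lborel v"
  shows "integrable lborel (\<lambda>y. v y * bump c s y)"
proof (rule Bochner_Integration.integrable_bound[OF v])
  have [measurable]: "v \<in> borel_measurable borel" using borel_measurable_integrable[OF v] by simp
  show "(\<lambda>y. v y * bump c s y) \<in> borel_measurable lborel" by measurable
  show "AE y in lborel. norm (v y * bump c s y) \<le> norm (v y)"
    by (rule AE_I2) (simp add: abs_mult mult_left_le bump_le_1)
qed

text \<open>Convolution with an unnormalised bump, so estimates carry the factor
  \<open>bump_mass\<close>. The integration variable is the centre: for fixed \<open>y\<close> the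
  integrand is continuous in \<open>x\<close>.\<close>

definition mollify :: "real \<Rightarrow> ('a::euclidean_space \<Rightarrow> real) \<Rightarrow> 'a \<Rightarrow> real" where
  "mollify s v x = (LINT y|lborel. v y * bump y s x)"

lemma mollify_nonneg: "(\<And>y. 0 \<le> v y) \<Longrightarrow> 0 \<le> mollify s v x"
  unfolding mollify_def by (intro Bochner_Integration.integral_nonneg mult_nonneg_nonneg) auto

lemma mollify_continuous:
  assumes v: "integrable lborel v"
  shows "continuous_on UNIV (mollify s v)"
  unfolding continuous_on_sequentially
proof (intro allI ballI impI, elim conjE)
  fix x :: "nat \<Rightarrow> 'a" and a assume x: "x \<longlonglongrightarrow> a"
  have [measurable]: "v \<in> borel_measurable borel" using borel_measurable_integrable[OF v] by simp
  have "(\<lambda>n. LINT y|lborel. v y * bump y s (x n)) \<longlonglongrightarrow> (LINT y|lborel. v y * bump y s a)"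
  proof (rule integral_dominated_convergence[where w="\<lambda>y. \<bar>v y\<bar>"])
    show "integrable lborel (\<lambda>y. \<bar>v y\<bar>)" using v by (rule integrable_abs)
    show "AE y in lborel. (\<lambda>n. v y * bump y s (x n)) \<longlonglongrightarrow> v y * bump y s a"
    proof (rule AE_I2)
      fix y
      have "isCont (bump y s) a"
        using continuous_on_bump[of y s] by (simp add: continuous_on_eq_continuous_at)
      then have "(\<lambda>n. bump y s (x n)) \<longlonglongrightarrow> bump y s a"
        using x by (rule isCont_tendsto_compose)
      then show "(\<lambda>n. v y * bump y s (x n)) \<longlonglongrightarrow> v y * bump y s a"
        by (intro tendsto_mult tendsto_const)
    qed
    show "AE y in lborel. norm (v y * bump y s (x n)) \<le> \<bar>v y\<bar>" for n
      by (rule AE_I2) (simp add: abs_mult mult_left_le bump_le_1)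
  qed measurable
  then show "(mollify s v \<circ> x) \<longlonglongrightarrow> mollify s v a" by (simp add: o_def mollify_def)
qed

text \<open>Taking \<open>UNIV\<close> for \<open>U\<close> gives the total mass; an open
  \<open>U\<close> moves the averaging from \<open>v\<close> onto the indicator of
  \<open>U\<close>.\<close>

lemma mollify_integral:
  fixes v :: "'a::euclidean_space \<Rightarrow> real"
  assumes v: "integrable lborel v" and s: "s > 0" and [measurable]: "U \<in> sets borel"
  shows "integrable lborel (\<lambda>x. indicator U x * mollify s v x)"
    and "(LINT x|lborel. indicator U x * mollify s v x)
      = (LINT y|lborel. v y * (LINT x|lborel. indicator U x * bump y s x))"
proof -
  have int: "integrable lborel (\<lambda>x. indicator U x * bump y s x)" for y
    by (rule Bochner_Integration.integrable_bound[OF integrable_bump[OF s, of y]])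
      (auto simp: indicator_def)
  have pair: "integrable (lborel \<Otimes>\<^sub>M lborel) (\<lambda>(y, x). v y * (indicator U x * bump y s x))"
  proof (rule integrable_mult_kernel[OF v, where C="bump_mass TYPE('a) s"])
    show "(\<lambda>(y, x). indicator U x * bump y s x) \<in> borel_measurable (borel \<Otimes>\<^sub>M borel)" by measurable
    show "integrable lborel (\<lambda>x. indicator U x * bump y s x)" for y by (rule int)
    have "(LINT x|lborel. \<bar>indicator U x * bump y s x\<bar>) \<le> (LINT x|lborel. bump y s x)" for y
      using int by (intro integral_mono integrable_abs integrable_bump[OF s]) (auto simp: indicator_def)
    then show "(LINT x|lborel. \<bar>indicator U x * bump y s x\<bar>) \<le> bump_mass TYPE('a) s" for y
      by (simp add: integral_bump)
  qed
  have e: "(LINT y|lborel. v y * (indicator U x * bump y s x)) = indicator U x * mollify s v x" for x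
    unfolding mollify_def by (subst integral_mult_right_zero[symmetric]) (simp add: algebra_simps)
  show "integrable lborel (\<lambda>x. indicator U x * mollify s v x)"
    using lborel_pair.integrable_snd[OF pair] by (simp add: e)
  show "(LINT x|lborel. indicator U x * mollify s v x)
      = (LINT y|lborel. v y * (LINT x|lborel. indicator U x * bump y s x))"
    using lborel_pair.Fubini_integral[OF pair] by (simp add: e)
qed

text \<open>Exchanging centre and point exchanges the increments \<open>z\<close> and
  \<open>- z\<close>, and the second difference is symmetric in these. It makes
  \<open>bump x s\<close> a test function in the variable \<open>y\<close>.\<close>

lemma frac_lap2_bump_commute: "frac_lap2 \<alpha> (bump y s) x = frac_lap2 \<alpha> (bump x s) y"
proof -
  have "bump y s (x + z) = bump x s (y - z)" "bump y s (x - z) = bump x s (y + z)" for z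
    by (simp_all add: bump_def inner_diff_left inner_diff_right inner_add_left inner_add_right
        inner_commute algebra_simps)
  then show ?thesis by (simp add: frac_lap2_def bump_commute[of y s x] algebra_simps)
qed

lemma frac_lap2_mollify:
  fixes v :: "'a::euclidean_space \<Rightarrow> real"
  assumes \<alpha>: "0 < \<alpha>" "\<alpha> < 1" and v: "integrable lborel v" and s: "s > 0"
  shows "integrable lborel (\<lambda>z. (2 * mollify s v x - mollify s v (x + z) - mollify s v (x - z)) * frac_ker \<alpha> z)"
    and "frac_lap2 \<alpha> (mollify s v) x = (LINT y|lborel. v y * frac_lap2 \<alpha> (bump x s) y)"
proof -
  let ?k = "\<lambda>y z. (2 * bump y s x - bump y s (x + z) - bump y s (x - z)) * frac_ker \<alpha> z"
  obtain C where C: "\<And>c x :: 'a.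
    (LINT z|lborel. \<bar>(2 * bump c s x - bump c s (x + z) - bump c s (x - z)) * frac_ker \<alpha> z\<bar>) \<le> C"
    using frac_lap2_bump_bounded[OF \<alpha> s, where 'a='a] by blast
  have pair: "integrable (lborel \<Otimes>\<^sub>M lborel) (\<lambda>(y, z). v y * ?k y z)"
  proof (rule integrable_mult_kernel[OF v, where C=C])
    show "(\<lambda>(y, z). ?k y z) \<in> borel_measurable (borel \<Otimes>\<^sub>M borel)" by measurable
    show "integrable lborel (?k y)" for y
      using \<alpha> s by (intro frac_lap2_integrable[where C="1804 * max 1 (1 / s ^ 2)"] bump_second_difference) auto
    show "(LINT z|lborel. \<bar>?k y z\<bar>) \<le> C" for y by (rule C)
  qed
  have int: "integrable lborel (\<lambda>y. v y * bump y s a)" for a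
    using integrable_mult_bump[OF v, of a s] by (simp only: bump_commute[of _ s a])
  have e: "(LINT y|lborel. v y * ?k y z)
      = (2 * mollify s v x - mollify s v (x + z) - mollify s v (x - z)) * frac_ker \<alpha> z" for z
  proof -
    have "(LINT y|lborel. v y * ?k y z) = (LINT y|lborel. (2 * (v y * bump y s x) - v y * bump y s (x + z)
        - v y * bump y s (x - z)) * frac_ker \<alpha> z)"
      by (rule Bochner_Integration.integral_cong[OF refl]) (simp add: algebra_simps)
    also have "\<dots> = (2 * mollify s v x - mollify s v (x + z) - mollify s v (x - z)) * frac_ker \<alpha> z"
      using int by (simp add: mollify_def)
    finally show ?thesis .
  qed
  show "integrable lborel (\<lambda>z. (2 * mollify s v x - mollify s v (x + z) - mollify s v (x - z)) * frac_ker \<alpha> z)"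
    using lborel_pair.integrable_snd[OF pair] by (simp only: e)
  have "frac_lap2 \<alpha> (mollify s v) x = (LINT z|lborel. LINT y|lborel. v y * ?k y z)"
    by (simp only: e frac_lap2_def)
  also have "\<dots> = (LINT y|lborel. LINT z|lborel. v y * ?k y z)"
    using lborel_pair.Fubini_integral[OF pair] .
  also have "\<dots> = (LINT y|lborel. v y * frac_lap2 \<alpha> (bump x s) y)"
    by (simp only: integral_mult_right_zero frac_lap2_def[symmetric] frac_lap2_bump_commute[of \<alpha> _ s x])
  finally show "frac_lap2 \<alpha> (mollify s v) x = (LINT y|lborel. v y * frac_lap2 \<alpha> (bump x s) y)" .
qed

text \<open>Duality replaces Lebesgue differentiation. The averages \<open>h n\<close> of the
  indicator of \<open>U\<close> lie between 0 and 1 and equal 1 at a point of \<open>U\<close> as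
  soon as the ball of radius \<open>s n\<close> around it is contained in \<open>U\<close>; hence
  convergence holds at every point of the open set.\<close>

lemma integral_open_le_of_mollify_le:
  fixes v :: "'a::euclidean_space \<Rightarrow> real"
  assumes v: "integrable lborel v" "\<And>y. 0 \<le> v y" and \<epsilon>: "\<epsilon> > 0"
    and U: "open U" "emeasure lborel U < \<infinity>"
    and bd: "\<And>x s. x \<in> U \<Longrightarrow> 0 < s \<Longrightarrow> s < \<epsilon> \<Longrightarrow> mollify s v x \<le> B * bump_mass TYPE('a) s"
  shows "(LINT y|lborel. indicator U y * v y) \<le> B * measure lborel U"
proof -
  have [measurable]: "v \<in> borel_measurable borel" using borel_measurable_integrable[OF v(1)] by simp
  have [measurable]: "U \<in> sets borel" using U(1) by simp
  \<comment> \<open>The shift by 2 makes \<open>s 0\<close> strictly smaller than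
    \<open>\<epsilon>\<close>.\<close>
  define s where "s n = \<epsilon> / real (n + 2)" for n
  have s: "0 < s n" "s n < \<epsilon>" for n using \<epsilon> by (auto simp: s_def field_simps add_pos_nonneg)
  have s_lim: "s \<longlonglongrightarrow> 0"
    unfolding s_def using LIMSEQ_ignore_initial_segment[OF lim_const_over_n[of \<epsilon>], of 2] by simp
  define h where "h n y = (LINT x|lborel. indicator U x * bump y (s n) x) / bump_mass TYPE('a) (s n)" for n y
  have int: "integrable lborel (\<lambda>x. indicator U x * bump y (s n) x)" for y n
    by (rule Bochner_Integration.integrable_bound[OF integrable_bump[OF s(1), of y n]])
      (auto simp: indicator_def)
  have A: "bump_mass TYPE('a) (s n) > 0" for n by (rule bump_mass_pos[OF s(1)])
  have h0: "0 \<le> h n y" for n y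
    unfolding h_def using A[of n] by (intro divide_nonneg_pos Bochner_Integration.integral_nonneg) auto
  have h1: "h n y \<le> 1" for n y
  proof -
    have "(LINT x|lborel. indicator U x * bump y (s n) x) \<le> (LINT x|lborel. bump y (s n) x)"
      using s int by (intro integral_mono integrable_bump) (auto simp: indicator_def)
    then show ?thesis using A[of n] by (simp add: h_def integral_bump)
  qed
  have [measurable]: "h n \<in> borel_measurable borel" for n unfolding h_def by measurable
  have "(\<lambda>n. LINT y|lborel. indicator U y * (v y * h n y)) \<longlonglongrightarrow> (LINT y|lborel. indicator U y * v y)"
  proof (rule integral_dominated_convergence[where w=v])
    show "integrable lborel v" by fact
    show "AE y in lborel. (\<lambda>n. indicator U y * (v y * h n y)) \<longlonglongrightarrow> indicator U y * v y"
    proof (rule AE_I2)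
      fix y
      show "(\<lambda>n. indicator U y * (v y * h n y)) \<longlonglongrightarrow> indicator U y * v y"
      proof (cases "y \<in> U")
        case True
        then obtain r where r: "r > 0" "ball y r \<subseteq> U" using U(1) openE by blast
        have "\<forall>\<^sub>F n in sequentially. s n < r" using s_lim r(1) by (rule order_tendstoD)
        then have "\<forall>\<^sub>F n in sequentially. h n y = 1"
        proof eventually_elim
          case (elim n)
          have eq: "indicator U x * bump y (s n) x = bump y (s n) x" for x
          proof (cases "x \<in> U")
            case False
            have "ball y (s n) \<subseteq> U" using elim r(2) subset_ball[of "s n" r y] by simp
            with False have "x \<notin> ball y (s n)" by blast
            then have "bump y (s n) x = 0" using bump_eq_0_iff[OF s(1)] by blast
            then show ?thesis by simp
          qed simp
          show ?case using A[of n] unfolding h_def eq integral_bump by simp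
        qed
        then have "(\<lambda>n. h n y) \<longlonglongrightarrow> 1" by (rule tendsto_eventually)
        then have "(\<lambda>n. indicator U y * (v y * h n y)) \<longlonglongrightarrow> indicator U y * (v y * 1)"
          by (intro tendsto_mult tendsto_const)
        then show ?thesis by simp
      qed simp
    qed
    show "AE y in lborel. norm (indicator U y * (v y * h n y)) \<le> v y" for n
      using v(2) h0[of n] h1[of n] by (auto intro!: AE_I2 simp: indicator_def abs_mult mult_left_le)
  qed measurable
  moreover have "(LINT y|lborel. indicator U y * (v y * h n y)) \<le> B * measure lborel U" for n
  proof -
    have "(LINT y|lborel. indicator U y * (v y * h n y)) \<le> (LINT y|lborel. v y * h n y)"
    proof (rule integral_mono)
      show "integrable lborel (\<lambda>y. v y * h n y)"
        by (rule Bochner_Integration.integrable_bound[OF v(1)])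
          (use v(2) h0 h1 in \<open>auto intro!: AE_I2 simp: abs_mult mult_left_le\<close>)
      show "integrable lborel (\<lambda>y. indicator U y * (v y * h n y))"
        by (rule Bochner_Integration.integrable_bound[OF v(1)])
          (use v(2) h0 h1 in \<open>auto intro!: AE_I2 simp: abs_mult mult_left_le indicator_def\<close>)
      show "indicator U y * (v y * h n y) \<le> v y * h n y" for y
        using v(2)[of y] h0[of n y] by (simp add: indicator_def)
    qed
    also have "\<dots> = (LINT x|lborel. indicator U x * mollify (s n) v x) / bump_mass TYPE('a) (s n)"
      unfolding h_def using mollify_integral(2)[OF v(1) s(1), of U n] by simp
    also have "\<dots> \<le> (LINT x|lborel. indicator U x * (B * bump_mass TYPE('a) (s n))) / bump_mass TYPE('a) (s n)"
    proof (intro divide_right_mono integral_mono)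
      show "integrable lborel (\<lambda>x. indicator U x * mollify (s n) v x)"
        by (rule mollify_integral(1)[OF v(1) s(1)]) simp
      show "integrable lborel (\<lambda>x. indicator U x * (B * bump_mass TYPE('a) (s n)))"
        using U by (intro integrable_mult_left integrable_real_indicator) auto
      show "indicator U x * mollify (s n) v x \<le> indicator U x * (B * bump_mass TYPE('a) (s n))" for x
        using bd[OF _ s] by (auto simp: indicator_def)
      show "0 \<le> bump_mass TYPE('a) (s n)" using A[of n] by simp
    qed
    also have "\<dots> = B * measure lborel U" using A[of n] by simp
    finally show ?thesis .
  qed
  ultimately show ?thesis by (intro LIMSEQ_le_const2) auto
qed

text \<open>Outer regularity carries the inequality from open sets to the set \<open>A\<close> where
  \<open>v\<close> exceeds \<open>B\<close>. There \<open>v - B\<close> is positive with integral at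
  most 0, so \<open>A\<close> is a null set.\<close>

lemma AE_le_of_integral_open_le:
  fixes v :: "'a::euclidean_space \<Rightarrow> real"
  assumes v: "integrable lborel v" "\<And>y. 0 \<le> v y" and B: "B \<ge> 0"
    and U: "open U" "emeasure lborel U < \<infinity>"
    and bd: "\<And>V. open V \<Longrightarrow> V \<subseteq> U \<Longrightarrow> (LINT y|lborel. indicator V y * v y) \<le> B * measure lborel V"
  shows "AE x in lborel. x \<in> U \<longrightarrow> v x \<le> B"
proof -
  have [measurable]: "v \<in> borel_measurable borel" using borel_measurable_integrable[OF v(1)] by simp
  have [measurable]: "U \<in> sets borel" using U(1) by simp
  define A where "A = {x \<in> space borel. x \<in> U \<and> B < v x}"
  have A[measurable]: "A \<in> sets borel" unfolding A_def by measurable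
  have AU: "A \<subseteq> U" by (auto simp: A_def)
  have Ufin: "emeasure lborel V < \<infinity>" if "V \<subseteq> U" for V
    using emeasure_mono[OF that, of lborel] U(2) by simp
  have vint: "integrable lborel (\<lambda>y. indicator V y * v y)" if [measurable]: "V \<in> sets borel" for V
    by (rule Bochner_Integration.integrable_bound[OF v(1)]) (auto simp: indicator_def)
  have le: "(LINT y|lborel. indicator A y * v y) \<le> B * measure lborel A"
  proof (rule field_le_epsilon)
    fix d :: real assume d: "d > 0"
    \<comment> \<open>Division by \<open>B + 1\<close> because \<open>B\<close> may be 0.\<close>
    define e where "e = d / (B + 1)"
    have e: "e > 0" "B * e \<le> d" using d B by (auto simp: e_def field_simps)
    obtain W where W: "open W" "A \<subseteq> W" "emeasure lborel (W - A) < e"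
      using outer_regular_lborel[OF A e(1)] by blast
    have [measurable]: "W \<in> sets borel" using W by simp
    let ?V = "W \<inter> U"
    have V: "open ?V" "?V \<subseteq> U" "A \<subseteq> ?V" using W U AU by auto
    have "(LINT y|lborel. indicator A y * v y) \<le> (LINT y|lborel. indicator ?V y * v y)"
      by (rule integral_mono[OF vint vint]) (use v(2) V(3) in \<open>auto simp: indicator_def\<close>)
    also have "\<dots> \<le> B * measure lborel ?V" using V by (intro bd) auto
    also have "measure lborel ?V \<le> measure lborel A + e"
    proof -
      have "measure lborel (?V - A) \<le> e"
      proof -
        have "emeasure lborel (?V - A) \<le> emeasure lborel (W - A)" by (intro emeasure_mono) auto
        also have "\<dots> \<le> ennreal e" using W(3) by simp
        finally show ?thesis using e(1) unfolding measure_def by (simp add: enn2real_leI)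
      qed
      moreover have "measure lborel (A \<union> (?V - A)) \<le> measure lborel A + measure lborel (?V - A)"
        by (rule measure_Un_le) auto
      moreover have "A \<union> (?V - A) = ?V" using V(3) by auto
      ultimately show ?thesis by simp
    qed
    then have "B * measure lborel ?V \<le> B * (measure lborel A + e)" using B by (rule mult_left_mono)
    finally show "(LINT y|lborel. indicator A y * v y) \<le> B * measure lborel A + d"
      using e by (simp add: algebra_simps)
  qed
  have Aint: "integrable lborel (\<lambda>y. indicator A y * B)"
    using Ufin[OF AU] by (intro integrable_mult_left integrable_real_indicator) auto
  have dint: "integrable lborel (\<lambda>y. indicator A y * v y - indicator A y * B)"
    by (intro Bochner_Integration.integrable_diff vint Aint) simp
  have nn: "0 \<le> indicator A y * v y - indicator A y * B" for y
    by (auto simp: indicator_def A_def)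
  have "(LINT y|lborel. indicator A y * v y - indicator A y * B) \<le> 0"
    using le by (subst Bochner_Integration.integral_diff[OF vint[OF A] Aint]) (simp add: mult.commute)
  moreover have "0 \<le> (LINT y|lborel. indicator A y * v y - indicator A y * B)"
    using nn by (intro Bochner_Integration.integral_nonneg)
  ultimately have "(LINT y|lborel. indicator A y * v y - indicator A y * B) = 0" by simp
  then have "AE y in lborel. indicator A y * v y - indicator A y * B = 0"
    using integral_nonneg_eq_0_iff_AE[OF dint] nn by simp
  then show ?thesis
    by eventually_elim (auto simp: indicator_def A_def split: if_splits)
qed

section \<open>Weak solutions\<close>

lemma upow_measurable [measurable (raw)]:
  assumes [measurable]: "f \<in> borel_measurable M"
  shows "(\<lambda>x. upow (f x) p) \<in> borel_measurable M"
  unfolding upow_def by measurable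

lemma upow_nonneg: "0 \<le> upow t p"
  by (simp add: upow_def)

lemma Gamma0_eq: "Gamma0 \<alpha> (x::'a::euclidean_space) = frac_const \<alpha> TYPE('a) * frac_ker \<alpha> x"
  by (simp add: Gamma0_def frac_ker_def)

lemma integrable_mult_frac_lap2_bump:
  fixes v :: "'a::euclidean_space \<Rightarrow> real"
  assumes "0 < \<alpha>" "\<alpha> < 1" "s > 0" and v: "integrable lborel v"
  shows "integrable lborel (\<lambda>x. v x * frac_lap2 \<alpha> (bump c s) x)"
proof -
  obtain C where C: "\<And>c x :: 'a. \<bar>frac_lap2 \<alpha> (bump c s) x\<bar> \<le> C"
    using frac_lap2_bump_bounded[OF assms(1-3), where 'a='a] by blast
  have [measurable]: "v \<in> borel_measurable borel" using borel_measurable_integrable[OF v] by simp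
  show ?thesis
  proof (rule Bochner_Integration.integrable_bound)
    show "integrable lborel (\<lambda>x. v x * C)" using v by (rule integrable_mult_left)
    show "AE x in lborel. norm (v x * frac_lap2 \<alpha> (bump c s) x) \<le> norm (v x * C)"
    proof (rule AE_I2)
      fix x
      have "\<bar>frac_lap2 \<alpha> (bump c s) x\<bar> \<le> \<bar>C\<bar>" using C[of c x] by linarith
      then show "norm (v x * frac_lap2 \<alpha> (bump c s) x) \<le> norm (v x * C)"
        unfolding real_norm_def abs_mult by (intro mult_left_mono) auto
    qed
  qed measurable
qed

text \<open>Replaces \<open>u\<close> by a representative that is nonnegative everywhere and 0
  outside the ball, so that all integrals run over the whole space, and separates the two terms of
  the equation, each integrable by itself.\<close>

lemma weak_solution_bump:
  fixes e :: "'a::euclidean_space"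
  assumes \<alpha>: "0 < \<alpha>" "\<alpha> < 1" and ws: "weak_solution \<alpha> p e u"
  obtains v where "integrable lborel v" "\<And>x. 0 \<le> v x"
    "\<And>c s. s > 0 \<Longrightarrow> cball c s \<subseteq> ball e 1 \<Longrightarrow> integrable lborel (\<lambda>x. upow (v x) p * bump c s x)"
    "\<And>c s. s > 0 \<Longrightarrow> cball c s \<subseteq> ball e 1 \<Longrightarrow>
      frac_const \<alpha> TYPE('a) / 2 * (LINT x|lborel. v x * frac_lap2 \<alpha> (bump c s) x)
        + (LINT x|lborel. upow (v x) p * bump c s x)
      = frac_const \<alpha> TYPE('a) * (LINT x|lborel. bump c s x * frac_ker \<alpha> x)"
proof -
  let ?\<Omega> = "ball e 1"
  define u0 where "u0 x = indicator ?\<Omega> x * u x" for x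
  define v where "v x = max 0 (u0 x)" for x
  have u0: "integrable lborel u0"
    using ws unfolding weak_solution_def set_integrable_def u0_def by simp
  then have [measurable]: "u0 \<in> borel_measurable borel" using borel_measurable_integrable by force
  have v: "integrable lborel v" unfolding v_def using u0 by (intro integrable_max) auto
  have [measurable]: "v \<in> borel_measurable borel" unfolding v_def by measurable
  have v0: "0 \<le> v x" for x by (simp add: v_def)
  have ae: "AE x in lborel. x \<in> ?\<Omega> \<longrightarrow> u x = v x"
    using ws unfolding weak_solution_def by (auto simp: v_def u0_def)
  have v_out: "x \<notin> ?\<Omega> \<Longrightarrow> v x = 0" for x by (simp add: v_def u0_def)
  show thesis
  proof (rule that[OF v v0])
    fix c :: 'a and s :: real assume s: "s > 0" and sub: "cball c s \<subseteq> ?\<Omega>"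
    \<comment> \<open>For \<open>p = 0\<close> the function \<open>upow (v x) p\<close> is 1 also
      where \<open>v\<close> vanishes; outside the ball it is the bump that removes this
      term.\<close>
    have b_out: "bump c s x = 0" if "x \<notin> ?\<Omega>" for x
    proof -
      have "x \<notin> ball c s" using that sub ball_subset_cball by blast
      then show ?thesis using bump_eq_0_iff[OF s] by blast
    qed
    have K: "integrable lborel (\<lambda>x. indicator (cball c s) x * upow (u x) p)"
      using ws sub unfolding weak_solution_def set_integrable_def by simp
    show i2: "integrable lborel (\<lambda>x. upow (v x) p * bump c s x)"
    proof (rule Bochner_Integration.integrable_bound[OF K])
      show "AE x in lborel. norm (upow (v x) p * bump c s x) \<le> norm (indicator (cball c s) x * upow (u x) p)"
        using ae
      proof eventually_elim
        case (elim x)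
        show ?case
        proof (cases "x \<in> ball c s")
          case True
          then have "x \<in> cball c s" using ball_subset_cball by blast
          moreover then have "u x = v x" using elim sub by blast
          ultimately show ?thesis by (simp add: upow_nonneg abs_mult mult_left_le bump_le_1)
        next
          case False
          then have "bump c s x = 0" using bump_eq_0_iff[OF s] by blast
          then show ?thesis by simp
        qed
      qed
    qed measurable
    have i1: "integrable lborel (\<lambda>x. v x * frac_lap2 \<alpha> (bump c s) x)"
      by (rule integrable_mult_frac_lap2_bump[OF \<alpha> s v])
    let ?c = "frac_const \<alpha> TYPE('a)"
    have fl: "frac_lap \<alpha> (bump c s) x = ?c / 2 * frac_lap2 \<alpha> (bump c s) x" for x
      by (rule frac_lap_bump[OF \<alpha> s])
    have "?c / 2 * (LINT x|lborel. v x * frac_lap2 \<alpha> (bump c s) x) + (LINT x|lborel. upow (v x) p * bump c s x)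
      = (LINT x|lborel. ?c / 2 * (v x * frac_lap2 \<alpha> (bump c s) x) + upow (v x) p * bump c s x)"
      using i1 i2 by simp
    also have "\<dots> = (LINT x:?\<Omega>|lborel. u x * frac_lap \<alpha> (bump c s) x + upow (u x) p * bump c s x)"
      unfolding set_lebesgue_integral_def
    proof (rule integral_cong_AE)
      \<comment> \<open>Only \<open>u0\<close> is known to be measurable on the whole space, so the
        integrand is expressed through it.\<close>
      have eq: "(\<lambda>x. indicator ?\<Omega> x *\<^sub>R (u x * frac_lap \<alpha> (bump c s) x + upow (u x) p * bump c s x))
        = (\<lambda>x. u0 x * (?c / 2 * frac_lap2 \<alpha> (bump c s) x) + indicator ?\<Omega> x * (upow (u0 x) p * bump c s x))"
        unfolding fl by (auto simp: fun_eq_iff indicator_def u0_def)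
      show "(\<lambda>x. indicator ?\<Omega> x *\<^sub>R (u x * frac_lap \<alpha> (bump c s) x + upow (u x) p * bump c s x))
          \<in> borel_measurable lborel" unfolding eq measurable_lborel1
        by (intro borel_measurable_add borel_measurable_times borel_measurable_const
            borel_measurable_indicator frac_lap2_measurable upow_measurable bump_measurable) auto
      show "AE x in lborel. ?c / 2 * (v x * frac_lap2 \<alpha> (bump c s) x) + upow (v x) p * bump c s x
        = indicator ?\<Omega> x *\<^sub>R (u x * frac_lap \<alpha> (bump c s) x + upow (u x) p * bump c s x)"
        using ae
      proof eventually_elim
        case (elim x)
        then show ?case unfolding fl
          by (cases "x \<in> ?\<Omega>") (simp_all add: v_out b_out del: mem_ball)
      qed
    qed measurable
    also have "\<dots> = (LINT x:?\<Omega>|lborel. bump c s x * Gamma0 \<alpha> x)"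
      using ws test_fun_bump[OF s sub] unfolding weak_solution_def by blast
    also have "\<dots> = (LINT x|lborel. ?c * (bump c s x * frac_ker \<alpha> x))"
      unfolding set_lebesgue_integral_def Gamma0_eq
    proof (rule Bochner_Integration.integral_cong[OF refl])
      fix x
      show "indicator ?\<Omega> x *\<^sub>R (bump c s x * (?c * frac_ker \<alpha> x)) = ?c * (bump c s x * frac_ker \<alpha> x)"
        by (cases "x \<in> ?\<Omega>") (simp_all add: b_out del: mem_ball)
    qed
    finally show "?c / 2 * (LINT x|lborel. v x * frac_lap2 \<alpha> (bump c s) x)
        + (LINT x|lborel. upow (v x) p * bump c s x)
      = ?c * (LINT x|lborel. bump c s x * frac_ker \<alpha> x)" by simp
  qed
qed

section \<open>The source term tested with bumps\<close>

lemma bump_frac_ker_le: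
  fixes c :: "'a::euclidean_space"
  assumes "0 < \<alpha>" "s > 0" "\<rho> > 0" and \<rho>: "\<And>x. x \<in> ball c s \<Longrightarrow> \<rho> \<le> norm x"
  shows "integrable lborel (\<lambda>x. bump c s x * frac_ker \<alpha> x)"
    and "(LINT x|lborel. bump c s x * frac_ker \<alpha> x) \<le> \<rho> powr (- real DIM('a) - 2 * \<alpha>) * bump_mass TYPE('a) s"
proof -
  let ?k = "\<rho> powr (- real DIM('a) - 2 * \<alpha>)"
  have le: "bump c s x * frac_ker \<alpha> x \<le> ?k * bump c s x" for x
  proof (cases "x \<in> ball c s")
    case True
    then have "frac_ker \<alpha> x \<le> ?k" using assms by (intro frac_ker_antimono) auto
    then show ?thesis unfolding mult.commute[of "bump c s x"] by (rule mult_right_mono) simp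
  next
    case False
    then have "bump c s x = 0" using bump_eq_0_iff[OF assms(2)] by blast
    then show ?thesis by simp
  qed
  have i: "integrable lborel (\<lambda>x. ?k * bump c s x)"
    using integrable_bump[OF assms(2)] by (rule integrable_mult_right)
  show i2: "integrable lborel (\<lambda>x. bump c s x * frac_ker \<alpha> x)"
    by (rule Bochner_Integration.integrable_bound[OF i]) (use le in \<open>auto intro!: AE_I2\<close>)
  have "(LINT x|lborel. bump c s x * frac_ker \<alpha> x) \<le> (LINT x|lborel. ?k * bump c s x)"
    by (rule integral_mono[OF i2 i le])
  then show "(LINT x|lborel. bump c s x * frac_ker \<alpha> x) \<le> ?k * bump_mass TYPE('a) s"
    by (simp add: integral_bump)
qed

text \<open>The origin is excluded from the ball because \<open>frac_ker\<close> has the value 0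
  there and the pointwise comparison would fail.\<close>

lemma bump_frac_ker_ge:
  fixes c :: "'a::euclidean_space"
  assumes "0 < \<alpha>" "s > 0" "\<sigma> > 0" and \<sigma>: "\<And>x. x \<in> ball c s \<Longrightarrow> x \<noteq> 0 \<and> norm x \<le> \<sigma>"
    and i2: "integrable lborel (\<lambda>x. bump c s x * frac_ker \<alpha> x)"
  shows "(LINT x|lborel. bump c s x * frac_ker \<alpha> x) \<ge> \<sigma> powr (- real DIM('a) - 2 * \<alpha>) * bump_mass TYPE('a) s"
proof -
  let ?k = "\<sigma> powr (- real DIM('a) - 2 * \<alpha>)"
  have le: "?k * bump c s x \<le> bump c s x * frac_ker \<alpha> x" for x
  proof (cases "x \<in> ball c s")
    case True
    have "?k = 1 / \<sigma> powr (real DIM('a) + 2 * \<alpha>)" by (simp add: powr_minus_divide[symmetric])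
    also have "\<dots> \<le> frac_ker \<alpha> x"
      unfolding frac_ker_def using \<sigma>[OF True] assms by (intro divide_left_mono powr_mono2 mult_pos_pos) auto
    finally show ?thesis unfolding mult.commute[of "bump c s x"] by (rule mult_right_mono) simp
  next
    case False
    then have "bump c s x = 0" using bump_eq_0_iff[OF assms(2)] by blast
    then show ?thesis by simp
  qed
  have i: "integrable lborel (\<lambda>x. ?k * bump c s x)"
    using integrable_bump[OF assms(2)] by (rule integrable_mult_right)
  have "(LINT x|lborel. ?k * bump c s x) \<le> (LINT x|lborel. bump c s x * frac_ker \<alpha> x)"
    by (rule integral_mono[OF i i2 le])
  then show ?thesis by (simp add: integral_bump)
qed

text \<open>Applies the sup bound to mollifications on balls of radius \<open>r / 4\<close>. The
  kernel part \<open>K * R powr (2 * \<alpha>)\<close> and the mass part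
  \<open>m / R ^ DIM('a)\<close> are both of order \<open>r powr (- DIM('a))\<close>, times the bump
  mass, which cancels on the way back to \<open>v\<close>.\<close>

lemma local_sup_bound:
  fixes v :: "'a::euclidean_space \<Rightarrow> real"
  assumes \<alpha>: "0 < \<alpha>" "\<alpha> < 1" and v: "integrable lborel v" "\<And>x. 0 \<le> v x" and e: "norm e = 1"
    and sub: "\<And>c s. s > 0 \<Longrightarrow> cball c s \<subseteq> ball e 1 \<Longrightarrow>
      (LINT x|lborel. v x * frac_lap2 \<alpha> (bump c s) x) \<le> 2 * (LINT x|lborel. bump c s x * frac_ker \<alpha> x)"
  shows "\<exists>B>0. \<forall>r. 0 < r \<longrightarrow> r \<le> 1 \<longrightarrow>
    (AE x in lborel. x \<in> ball (r *\<^sub>R e) (r / 2) \<longrightarrow> v x \<le> B / r ^ DIM('a))"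
proof -
  let ?n = "DIM('a)"
  obtain C where C: "C > 0" and sup: "\<forall>(w :: 'a \<Rightarrow> real) x0 R m K.
    R > 0 \<longrightarrow> K \<ge> 0 \<longrightarrow> continuous_on UNIV w \<longrightarrow> (\<forall>x. w x \<ge> 0) \<longrightarrow> integrable lborel w \<longrightarrow>
    integral\<^sup>L lborel w \<le> m \<longrightarrow>
    (\<forall>x\<in>ball x0 R. integrable lborel (\<lambda>z. (2 * w x - w (x + z) - w (x - z)) * frac_ker \<alpha> z) \<and>
       frac_lap2 \<alpha> w x \<le> K) \<longrightarrow>
    w x0 \<le> C * (K * R powr (2 * \<alpha>) + m / R ^ ?n)"
    using sup_bound_frac_subsolution[OF \<alpha>, where 'a='a] by (elim exE conjE)
  define m where "m = integral\<^sup>L lborel v"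
  have m: "m \<ge> 0" unfolding m_def using v(2) by (intro Bochner_Integration.integral_nonneg)
  \<comment> \<open>The numerical factor left when \<open>r\<close> is taken out of the source bound
    at distance \<open>r / 8\<close> times \<open>(r / 4) powr (2 * \<alpha>)\<close>.\<close>
  define k where "k = (1 / 8 :: real) powr (- real ?n - 2 * \<alpha>) * (1 / 4) powr (2 * \<alpha>)"
  have k: "k > 0" by (simp add: k_def)
  define B where "B = C * (2 * k + m * 4 ^ ?n)"
  have B: "B > 0" unfolding B_def using C k m by (intro mult_pos_pos add_pos_nonneg) auto
  show ?thesis
  proof (intro exI[of _ B] conjI allI impI B)
    fix r :: real assume r: "0 < r" "r \<le> 1"
    let ?U = "ball (r *\<^sub>R e) (r / 2)"
    have bound: "mollify s v x0 \<le> (B / r ^ ?n) * bump_mass TYPE('a) s"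
      if x0: "x0 \<in> ?U" and s: "0 < s" "s < r / 8" for x0 s
    proof -
      let ?A = "bump_mass TYPE('a) s"
      have A: "?A > 0" by (rule bump_mass_pos[OF s(1)])
      have "mollify s v x0 \<le> C * ((2 * ((r / 8) powr (- real ?n - 2 * \<alpha>) * ?A)) * (r / 4) powr (2 * \<alpha>)
          + (m * ?A) / (r / 4) ^ ?n)"
      proof (rule sup[THEN spec, THEN spec, THEN spec, THEN spec, THEN spec, THEN mp, THEN mp, THEN mp, THEN mp, THEN mp, THEN mp, THEN mp])
        show "r / 4 > 0" using r by simp
        show "0 \<le> 2 * ((r / 8) powr (- real ?n - 2 * \<alpha>) * ?A)" using A by simp
        show "continuous_on UNIV (mollify s v)" by (rule mollify_continuous[OF v(1)])
        show "\<forall>x. 0 \<le> mollify s v x" using mollify_nonneg[of v, OF v(2)] by blast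
        show "integrable lborel (mollify s v)" using mollify_integral(1)[OF v(1) s(1), of UNIV] by simp
        show "integral\<^sup>L lborel (mollify s v) \<le> m * ?A"
          using mollify_integral(2)[OF v(1) s(1), of UNIV] by (simp add: integral_bump m_def)
        show "\<forall>x\<in>ball x0 (r / 4). integrable lborel (\<lambda>z. (2 * mollify s v x - mollify s v (x + z) - mollify s v (x - z)) * frac_ker \<alpha> z)
           \<and> frac_lap2 \<alpha> (mollify s v) x \<le> 2 * ((r / 8) powr (- real ?n - 2 * \<alpha>) * ?A)"
        proof (intro ballI conjI)
          fix x assume x: "x \<in> ball x0 (r / 4)"
          \<comment> \<open>The margins are \<open>r / 2\<close> for \<open>x0\<close>,
            \<open>r / 4\<close> for the sup bound and \<open>r / 8\<close> for the bump. Their sum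
            \<open>7 * r / 8\<close> is below \<open>r\<close>, so each bump stays in
            \<open>ball e 1\<close> and at distance at least \<open>r / 8\<close> from the
            origin.\<close>
          have xr: "norm (x - r *\<^sub>R e) < 3 * r / 4"
            using x x0 dist_triangle[of "r *\<^sub>R e" x x0] by (simp add: dist_norm norm_minus_commute)
          have far: "norm (y - r *\<^sub>R e) < 7 * r / 8" if "y \<in> cball x s" for y
          proof -
            have "norm (y - r *\<^sub>R e) \<le> norm (y - x) + norm (x - r *\<^sub>R e)"
              using norm_triangle_ineq[of "y - x" "x - r *\<^sub>R e"] by simp
            also have "norm (y - x) \<le> s" using that by (simp add: dist_norm norm_minus_commute)
            finally show ?thesis using xr s by simp
          qed
          show "integrable lborel (\<lambda>z. (2 * mollify s v x - mollify s v (x + z) - mollify s v (x - z)) * frac_ker \<alpha> z)"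
            by (rule frac_lap2_mollify(1)[OF \<alpha> v(1) s(1)])
          have "frac_lap2 \<alpha> (mollify s v) x = (LINT y|lborel. v y * frac_lap2 \<alpha> (bump x s) y)"
            by (rule frac_lap2_mollify(2)[OF \<alpha> v(1) s(1)])
          also have "\<dots> \<le> 2 * (LINT y|lborel. bump x s y * frac_ker \<alpha> y)"
          proof (rule sub[OF s(1)])
            show "cball x s \<subseteq> ball e 1"
            proof
              fix y assume "y \<in> cball x s"
              have "norm (y - e) \<le> norm (y - r *\<^sub>R e) + norm (r *\<^sub>R e - e)"
                using norm_triangle_ineq[of "y - r *\<^sub>R e" "r *\<^sub>R e - e"] by simp
              also have "norm (r *\<^sub>R e - e) = 1 - r"
              proof -
                have "r *\<^sub>R e - e = (r - 1) *\<^sub>R e" by (simp add: algebra_simps)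
                then show ?thesis using e r by simp
              qed
              finally have "norm (y - e) < 1" using far[OF \<open>y \<in> cball x s\<close>] r by simp
              then show "y \<in> ball e 1" by (simp add: dist_norm norm_minus_commute)
            qed
          qed
          also have "\<dots> \<le> 2 * ((r / 8) powr (- real ?n - 2 * \<alpha>) * ?A)"
          proof (intro mult_left_mono bump_frac_ker_le(2)[OF \<alpha>(1) s(1)])
            fix y assume "y \<in> ball x s"
            then have "y \<in> cball x s" using ball_subset_cball by blast
            from far[OF this] show "r / 8 \<le> norm y"
              using norm_triangle_ineq2[of "r *\<^sub>R e" y] e r by (simp add: norm_minus_commute)
          qed (use r in auto)
          finally show "frac_lap2 \<alpha> (mollify s v) x \<le> 2 * ((r / 8) powr (- real ?n - 2 * \<alpha>) * ?A)" .
        qed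
      qed
      also have "\<dots> = (B / r ^ ?n) * ?A"
      proof -
        have "(r / 8) powr (- real ?n - 2 * \<alpha>) * (r / 4) powr (2 * \<alpha>)
          = k * (r powr (- real ?n - 2 * \<alpha>) * r powr (2 * \<alpha>))"
          using r powr_mult[of r "1/8"] powr_mult[of r "1/4"] by (simp add: k_def)
        also have "r powr (- real ?n - 2 * \<alpha>) * r powr (2 * \<alpha>) = 1 / r ^ ?n"
          using r by (simp add: powr_add[symmetric] powr_minus_divide powr_realpow)
        finally have kk: "(r / 8) powr (- real ?n - 2 * \<alpha>) * (r / 4) powr (2 * \<alpha>) = k / r ^ ?n" by simp
        have "(2 * ((r / 8) powr (- real ?n - 2 * \<alpha>) * ?A)) * (r / 4) powr (2 * \<alpha>)
          = 2 * ?A * ((r / 8) powr (- real ?n - 2 * \<alpha>) * (r / 4) powr (2 * \<alpha>))" by simp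
        also have "\<dots> = 2 * ?A * (k / r ^ ?n)" unfolding kk ..
        finally show ?thesis using r by (simp add: B_def power_divide field_simps)
      qed
      finally show ?thesis .
    qed
    show "AE x in lborel. x \<in> ?U \<longrightarrow> v x \<le> B / r ^ ?n"
    proof (rule AE_le_of_integral_open_le[OF v])
      show "0 \<le> B / r ^ ?n" using B r by simp
      show "open ?U" by simp
      show "emeasure lborel ?U < \<infinity>" by (rule emeasure_lborel_ball_finite)
      fix V assume V: "open V" "V \<subseteq> ?U"
      show "(LINT y|lborel. indicator V y * v y) \<le> B / r ^ ?n * measure lborel V"
      proof (rule integral_open_le_of_mollify_le[OF v])
        show "0 < r / 8" using r by simp
        show "emeasure lborel V < \<infinity>"
          using emeasure_mono[OF V(2), of lborel] emeasure_lborel_ball_finite[of "r *\<^sub>R e" "r / 2"] by simp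
      qed (use V bound in auto)
    qed
  qed
qed

section \<open>Contradiction from bumps shrinking to the origin\<close>

theorem theorem1p2:
  fixes e :: "'a::euclidean_space" and \<alpha> p :: real
  assumes "DIM('a) \<ge> 2"
    and "e \<in> Basis"
    and "0 < \<alpha>" "\<alpha> < 1"
    and "0 \<le> p" "p \<le> 1 + 2 * \<alpha> / real DIM('a)"
  shows "\<not> (\<exists>u :: 'a \<Rightarrow> real. weak_solution \<alpha> p e u)"
proof
  assume "\<exists>u :: 'a \<Rightarrow> real. weak_solution \<alpha> p e u"
  then obtain u where ws: "weak_solution \<alpha> p e u" by blast
  note \<alpha> = assms(3,4)
  let ?n = "DIM('a)"
  define c0 where "c0 = frac_const \<alpha> TYPE('a)"
  have c0: "c0 > 0" unfolding c0_def by (rule frac_const_pos[OF \<alpha>])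
  have e: "norm e = 1" using assms(2) by simp
  obtain v where v: "integrable lborel v" "\<And>x. 0 \<le> v x"
    and vp: "\<And>c s. s > 0 \<Longrightarrow> cball c s \<subseteq> ball e 1 \<Longrightarrow> integrable lborel (\<lambda>x. upow (v x) p * bump c s x)"
    and eq: "\<And>c s. s > 0 \<Longrightarrow> cball c s \<subseteq> ball e 1 \<Longrightarrow>
      c0 / 2 * (LINT x|lborel. v x * frac_lap2 \<alpha> (bump c s) x)
        + (LINT x|lborel. upow (v x) p * bump c s x)
      = c0 * (LINT x|lborel. bump c s x * frac_ker \<alpha> x)"
    unfolding c0_def by (rule weak_solution_bump[OF \<alpha> ws]) blast
  have [measurable]: "v \<in> borel_measurable borel" using borel_measurable_integrable[OF v(1)] by simp
  define r where "r n = 1 / real (Suc n)" for n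
  have r: "0 < r n" "r n \<le> 1" for n by (simp_all add: r_def)
  have r_lim: "r \<longlonglongrightarrow> 0" unfolding r_def by (rule lim_1_over_n[THEN LIMSEQ_Suc])
  define \<xi> where "\<xi> n = bump (r n *\<^sub>R e) (r n / 2)" for n
  have r2: "0 < r n / 2" for n using r by simp
  have re: "cball (r n *\<^sub>R e) (r n / 2) \<subseteq> ball e 1" for n
  proof
    fix y assume "y \<in> cball (r n *\<^sub>R e) (r n / 2)"
    then have "norm (y - r n *\<^sub>R e) \<le> r n / 2" by (simp add: dist_norm norm_minus_commute)
    moreover have "norm (y - e) \<le> norm (y - r n *\<^sub>R e) + norm (r n *\<^sub>R e - e)"
      using norm_triangle_ineq[of "y - r n *\<^sub>R e" "r n *\<^sub>R e - e"] by simp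
    moreover have "norm (r n *\<^sub>R e - e) = 1 - r n"
    proof -
      have "r n *\<^sub>R e - e = (r n - 1) *\<^sub>R e" by (simp add: algebra_simps)
      then show ?thesis using e r[of n] by simp
    qed
    ultimately have "norm (y - e) < 1" using r[of n] by linarith
    then show "y \<in> ball e 1" by (simp add: dist_norm norm_minus_commute)
  qed
  have ball_norm: "r n / 2 \<le> norm y \<and> norm y \<le> 2 * r n" if "y \<in> ball (r n *\<^sub>R e) (r n / 2)" for y n
  proof -
    have "norm (y - r n *\<^sub>R e) < r n / 2" using that by (simp add: dist_norm norm_minus_commute)
    moreover have "norm (r n *\<^sub>R e) = r n" using e r[of n] by simp
    ultimately show ?thesis
      using norm_triangle_ineq2[of "r n *\<^sub>R e" y] norm_triangle_ineq2[of y "r n *\<^sub>R e"]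
        norm_minus_commute[of y "r n *\<^sub>R e"] r[of n] by linarith
  qed
  define S where "S n = (LINT x|lborel. upow (v x) p * \<xi> n x)" for n
  define G where "G = frac_lap2 \<alpha> (bump (0::'a) 1)"
  have [measurable]: "G \<in> borel_measurable borel" unfolding G_def by measurable
  \<comment> \<open>By scaling, the nonlocal term tested with \<open>\<xi> n\<close> is
    \<open>(r n / 2) powr (- 2 * \<alpha>) * T n\<close>.\<close>
  define T where "T n = (LINT y|lborel. v y * G ((1 / (r n / 2)) *\<^sub>R (y - r n *\<^sub>R e)))" for n
  \<comment> \<open>The first factor comes from \<open>norm x <= 2 * r n\<close> on the support, the
    second from the mass of a bump of radius \<open>r n / 2\<close>.\<close>
  define \<kappa> where "\<kappa> = 2 powr (- real ?n - 2 * \<alpha>) * (1 / 2) ^ ?n * bump_mass TYPE('a) 1"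
  have \<kappa>: "\<kappa> > 0" unfolding \<kappa>_def using bump_mass_pos[of 1, where 'a='a] by simp
  have rp: "(r n / 2) powr (- 2 * \<alpha>) = 2 powr (2 * \<alpha>) * r n powr (- 2 * \<alpha>)" for n
    using r[of n] by (simp add: powr_divide powr_minus field_simps)

  have T0: "T \<longlonglongrightarrow> 0"
  proof -
    obtain C where C: "\<And>x. \<bar>G x\<bar> \<le> C"
      unfolding G_def using frac_lap2_bump_bounded[OF \<alpha> zero_less_one, where 'a='a] by blast
    have "(\<lambda>n. LINT y|lborel. v y * G ((1 / (r n / 2)) *\<^sub>R (y - r n *\<^sub>R e))) \<longlonglongrightarrow> (LINT y|(lborel::'a measure). 0)"
    proof (rule integral_dominated_convergence[where w="\<lambda>y. v y * C"])
      show "integrable lborel (\<lambda>y. v y * C)" using v(1) by (rule integrable_mult_left)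
      show "AE y in lborel. norm (v y * G ((1 / (r n / 2)) *\<^sub>R (y - r n *\<^sub>R e))) \<le> v y * C" for n
        using v(2) C by (intro AE_I2) (simp add: abs_mult mult_left_mono)
      \<comment> \<open>At \<open>y = 0\<close> the rescaled points stay at
        \<open>-2 *\<^sub>R e\<close>, so the origin is left out as a null set.\<close>
      show "AE y in lborel. (\<lambda>n. v y * G ((1 / (r n / 2)) *\<^sub>R (y - r n *\<^sub>R e))) \<longlonglongrightarrow> 0"
        using AE_lborel_singleton[of "0::'a"]
      proof eventually_elim
        case (elim y)
        have "filterlim (\<lambda>n. (1 / (r n / 2)) *\<^sub>R (y - r n *\<^sub>R e)) at_infinity sequentially"
        proof (rule filterlim_norm_at_top_imp_at_infinity)
          show "filterlim (\<lambda>n. norm ((1 / (r n / 2)) *\<^sub>R (y - r n *\<^sub>R e))) at_top sequentially"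
          proof (rule filterlim_at_top_mono)
            \<comment> \<open>The scaling factor \<open>1 / (r n / 2)\<close> is
              \<open>2 * real (Suc n)\<close>, and it moves the centre to norm 2; hence the lower
              bound \<open>2 * norm y * real (Suc n) - 2\<close>.\<close>
            have "filterlim (\<lambda>n. 2 * norm y * real (Suc n)) at_top sequentially"
              using elim by (intro filterlim_tendsto_pos_mult_at_top[OF tendsto_const]
                  filterlim_compose[OF filterlim_real_sequentially filterlim_Suc]) auto
            from filterlim_tendsto_add_at_top[OF tendsto_const[of "-2"] this]
            show "filterlim (\<lambda>n. - 2 + 2 * norm y * real (Suc n)) at_top sequentially" .
            show "\<forall>\<^sub>F n in sequentially. - 2 + 2 * norm y * real (Suc n)
                \<le> norm ((1 / (r n / 2)) *\<^sub>R (y - r n *\<^sub>R e))"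
            proof (intro always_eventually allI)
              fix n
              have "norm y - r n \<le> norm (y - r n *\<^sub>R e)"
                using norm_triangle_ineq2[of y "r n *\<^sub>R e"] e r[of n] by simp
              then have "2 * real (Suc n) * (norm y - r n) \<le> 2 * real (Suc n) * norm (y - r n *\<^sub>R e)"
                by (intro mult_left_mono) auto
              moreover have "2 * real (Suc n) * (norm y - r n) = - 2 + 2 * norm y * real (Suc n)"
                by (simp add: r_def field_simps)
              moreover have "norm ((1 / (r n / 2)) *\<^sub>R (y - r n *\<^sub>R e)) = 2 * real (Suc n) * norm (y - r n *\<^sub>R e)"
                by (simp add: r_def)
              ultimately show "- 2 + 2 * norm y * real (Suc n)
                \<le> norm ((1 / (r n / 2)) *\<^sub>R (y - r n *\<^sub>R e))" by linarith
            qed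
          qed
        qed
        then have "(\<lambda>n. G ((1 / (r n / 2)) *\<^sub>R (y - r n *\<^sub>R e))) \<longlonglongrightarrow> 0"
          unfolding G_def by (rule filterlim_compose[OF frac_lap2_bump_decay[OF \<alpha>]])
        then show ?case by (rule tendsto_mult_right_zero)
      qed
    qed measurable
    then show ?thesis unfolding T_def[abs_def] by simp
  qed

  have S_ge: "S n \<ge> r n powr (- 2 * \<alpha>) * (c0 * \<kappa> - c0 / 2 * (2 powr (2 * \<alpha>) * T n))" for n
  proof -
    have "(LINT x|lborel. v x * frac_lap2 \<alpha> (\<xi> n) x) = (r n / 2) powr (- 2 * \<alpha>) * T n"
    proof -
      have "(LINT x|lborel. v x * frac_lap2 \<alpha> (\<xi> n) x)
        = (LINT x|lborel. (r n / 2) powr (- 2 * \<alpha>) * (v x * G ((1 / (r n / 2)) *\<^sub>R (x - r n *\<^sub>R e))))"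
        unfolding \<xi>_def frac_lap2_bump_scale[OF r2] G_def
        by (rule Bochner_Integration.integral_cong[OF refl]) (simp only: mult.left_commute)
      then show ?thesis by (simp only: integral_mult_right_zero T_def)
    qed
    moreover have "r n powr (- 2 * \<alpha>) * \<kappa> \<le> (LINT x|lborel. \<xi> n x * frac_ker \<alpha> x)"
    proof -
      have "(2 * r n) powr (- real ?n - 2 * \<alpha>) * bump_mass TYPE('a) (r n / 2)
          \<le> (LINT x|lborel. \<xi> n x * frac_ker \<alpha> x)"
        unfolding \<xi>_def
      proof (rule bump_frac_ker_ge[OF \<alpha>(1) r2])
        show "0 < 2 * r n" using r[of n] by simp
        show "y \<noteq> 0 \<and> norm y \<le> 2 * r n" if "y \<in> ball (r n *\<^sub>R e) (r n / 2)" for y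
          using ball_norm[OF that] r[of n] by auto
        show "integrable lborel (\<lambda>x. bump (r n *\<^sub>R e) (r n / 2) x * frac_ker \<alpha> x)"
          by (rule bump_frac_ker_le(1)[OF \<alpha>(1) r2 r2]) (use ball_norm in blast)
      qed
      moreover have "(2 * r n) powr (- real ?n - 2 * \<alpha>) * bump_mass TYPE('a) (r n / 2) = r n powr (- 2 * \<alpha>) * \<kappa>"
      proof -
        have "r n powr (- real ?n - 2 * \<alpha>) * r n ^ ?n = r n powr (- 2 * \<alpha>)"
          using r[of n] by (simp add: powr_realpow[symmetric] powr_add[symmetric])
        then show ?thesis
          using r[of n] bump_mass_scale[OF r2[of n], where 'a='a]
          by (simp add: powr_mult \<kappa>_def power_divide)
      qed
      ultimately show ?thesis by simp
    qed
    then have "c0 * (r n powr (- 2 * \<alpha>) * \<kappa>) \<le> c0 * (LINT x|lborel. \<xi> n x * frac_ker \<alpha> x)"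
      using c0 by (intro mult_left_mono) auto
    ultimately show ?thesis
      using eq[OF r2 re, of n] unfolding \<xi>_def[symmetric] S_def[symmetric] rp by (simp add: algebra_simps)
  qed
  have S_ge2: "\<forall>\<^sub>F n in sequentially. r n powr (- 2 * \<alpha>) * (c0 * \<kappa> / 2) \<le> S n"
  proof -
    \<comment> \<open>The bracket tends to \<open>c0 * \<kappa>\<close>, so half of it is an
      eventual lower bound.\<close>
    have "(\<lambda>n. c0 * \<kappa> - c0 / 2 * (2 powr (2 * \<alpha>) * T n)) \<longlonglongrightarrow> c0 * \<kappa> - c0 / 2 * (2 powr (2 * \<alpha>) * 0)"
      by (intro tendsto_intros T0)
    then have "\<forall>\<^sub>F n in sequentially. c0 * \<kappa> / 2 < c0 * \<kappa> - c0 / 2 * (2 powr (2 * \<alpha>) * T n)"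
      using c0 \<kappa> by (intro order_tendstoD(1)) auto
    then show ?thesis
    proof eventually_elim
      case (elim n)
      then have "r n powr (- 2 * \<alpha>) * (c0 * \<kappa> / 2) \<le> r n powr (- 2 * \<alpha>) * (c0 * \<kappa> - c0 / 2 * (2 powr (2 * \<alpha>) * T n))"
        by (intro mult_left_mono) auto
      with S_ge[of n] show ?case by linarith
    qed
  qed

  show False
  proof (cases "p \<le> 1")
    case True
    let ?M = "bump_mass TYPE('a) 1 + integral\<^sup>L lborel v"
    have SM: "S n \<le> ?M" for n
    proof -
      have i: "integrable lborel (\<lambda>x. \<xi> n x + v x)"
        unfolding \<xi>_def by (intro Bochner_Integration.integrable_add integrable_bump r2 v)
      have "S n \<le> (LINT x|lborel. \<xi> n x + v x)"
        unfolding S_def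
      proof (rule integral_mono[OF _ i])
        show "integrable lborel (\<lambda>x. upow (v x) p * \<xi> n x)" unfolding \<xi>_def by (rule vp[OF r2 re])
        fix x
        have "upow (v x) p \<le> 1 + v x"
        proof (cases "p = 0 \<or> v x \<le> 1")
          case True
          then have "upow (v x) p \<le> 1" using v(2)[of x] assms(5) by (auto simp: upow_def powr_le1)
          then show ?thesis using v(2)[of x] by simp
        next
          case False
          then have "v x powr p \<le> v x powr 1" using \<open>p \<le> 1\<close> by (intro powr_mono) auto
          then show ?thesis using False by (simp add: upow_def)
        qed
        then have "upow (v x) p * \<xi> n x \<le> (1 + v x) * \<xi> n x"
          by (rule mult_right_mono) (simp add: \<xi>_def)
        also have "\<dots> \<le> \<xi> n x + v x"
          using v(2)[of x] bump_le_1[of "r n *\<^sub>R e" "r n / 2" x] by (simp add: \<xi>_def distrib_right mult_left_le)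
        finally show "upow (v x) p * \<xi> n x \<le> \<xi> n x + v x" .
      qed
      also have "\<dots> = bump_mass TYPE('a) (r n / 2) + integral\<^sup>L lborel v"
        unfolding \<xi>_def by (subst Bochner_Integration.integral_add[OF integrable_bump[OF r2] v(1)]) (simp add: integral_bump)
      also have "bump_mass TYPE('a) (r n / 2) \<le> bump_mass TYPE('a) 1"
      proof -
        have "(r n / 2) ^ ?n \<le> 1" using r[of n] by (intro power_le_one) auto
        then show ?thesis
          using bump_mass_pos[of 1, where 'a='a] by (subst bump_mass_scale[OF r2]) (simp add: mult_left_le_one_le)
      qed
      finally show ?thesis by simp
    qed
    have "\<forall>\<^sub>F n in sequentially. r n powr (- 2 * \<alpha>) * (c0 * \<kappa> / 2) \<le> ?M"
      using S_ge2 by eventually_elim (rule order_trans[OF _ SM])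
    \<comment> \<open>\<open>real (Suc n)\<close> is \<open>1 / r n\<close>. Multiplying by its
      negative power compares a null sequence with a positive constant.\<close>
    moreover have "\<forall>\<^sub>F n in sequentially. ?M * real (Suc n) powr (- (2 * \<alpha>)) < c0 * \<kappa> / 2"
    proof (rule order_tendstoD(2))
      have "(\<lambda>n. real (Suc n) powr (- (2 * \<alpha>))) \<longlonglongrightarrow> 0"
        using \<alpha> by (intro tendsto_neg_powr filterlim_compose[OF filterlim_real_sequentially filterlim_Suc]) auto
      then show "(\<lambda>n. ?M * real (Suc n) powr (- (2 * \<alpha>))) \<longlonglongrightarrow> 0"
        by (rule tendsto_mult_right_zero)
      show "0 < c0 * \<kappa> / 2" using c0 \<kappa> by simp
    qed
    ultimately have "\<forall>\<^sub>F n in sequentially. False"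
    proof eventually_elim
      case (elim n)
      let ?R = "real (Suc n)"
      have "r n powr (- 2 * \<alpha>) = ?R powr (2 * \<alpha>)"
        unfolding r_def by (simp add: powr_minus powr_divide del: of_nat_Suc)
      then have "?R powr (2 * \<alpha>) * (c0 * \<kappa> / 2) * ?R powr (- (2 * \<alpha>)) \<le> ?M * ?R powr (- (2 * \<alpha>))"
        using elim(1) by (intro mult_right_mono) auto
      moreover have "?R powr (2 * \<alpha>) * ?R powr (- (2 * \<alpha>)) = 1"
        by (simp add: powr_add[symmetric] del: of_nat_Suc)
      then have "?R powr (2 * \<alpha>) * (c0 * \<kappa> / 2) * ?R powr (- (2 * \<alpha>)) = c0 * \<kappa> / 2"
        by (metis mult.assoc mult.commute mult_1)
      ultimately show False using elim(2) by linarith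
    qed
    then show False by simp
  next
    case False
    then have p: "p > 1" by simp
    \<comment> \<open>Dropping the nonnegative term with \<open>upow\<close> makes \<open>v\<close>
      a subsolution, and \<open>c0 > 0\<close> cancels.\<close>
    have sub: "(LINT x|lborel. v x * frac_lap2 \<alpha> (bump c s) x) \<le> 2 * (LINT x|lborel. bump c s x * frac_ker \<alpha> x)"
      if "s > 0" "cball c s \<subseteq> ball e 1" for c s
    proof -
      have "0 \<le> (LINT x|lborel. upow (v x) p * bump c s x)"
        by (intro Bochner_Integration.integral_nonneg mult_nonneg_nonneg upow_nonneg bump_nonneg)
      then have "c0 * (LINT x|lborel. v x * frac_lap2 \<alpha> (bump c s) x) \<le> c0 * (2 * (LINT x|lborel. bump c s x * frac_ker \<alpha> x))"
        using eq[OF that] by (simp add: field_simps)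
      then show ?thesis using c0 by (simp only: mult_le_cancel_left_pos)
    qed
    obtain B where B: "B > 0" and vB: "\<And>r. 0 < r \<Longrightarrow> r \<le> 1 \<Longrightarrow>
      (AE x in lborel. x \<in> ball (r *\<^sub>R e) (r / 2) \<longrightarrow> v x \<le> B / r ^ ?n)"
      using local_sup_bound[OF \<alpha> v e sub] by blast
    define M where "M n = (LINT x|lborel. v x * \<xi> n x)" for n
    have vi: "integrable lborel (\<lambda>x. v x * \<xi> n x)" for n
      unfolding \<xi>_def by (rule integrable_mult_bump[OF v(1)])
    have M0: "0 \<le> M n" for n
      unfolding M_def \<xi>_def using v(2) by (intro Bochner_Integration.integral_nonneg mult_nonneg_nonneg) auto
    have M_lim: "M \<longlonglongrightarrow> 0"
    proof -
      have "(\<lambda>n. LINT x|lborel. v x * \<xi> n x) \<longlonglongrightarrow> (LINT x|(lborel::'a measure). 0)"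
      proof (rule integral_dominated_convergence[where w=v])
        show "AE x in lborel. norm (v x * \<xi> n x) \<le> v x" for n
          using v(2) by (intro AE_I2) (simp add: \<xi>_def abs_mult mult_left_le bump_le_1)
        show "AE x in lborel. (\<lambda>n. v x * \<xi> n x) \<longlonglongrightarrow> 0"
          using AE_lborel_singleton[of "0::'a"]
        proof eventually_elim
          case (elim x)
          have "(\<lambda>n. 2 * r n) \<longlonglongrightarrow> 0" using r_lim by (rule tendsto_mult_right_zero)
          then have "\<forall>\<^sub>F n in sequentially. 2 * r n < norm x" 
            by (rule order_tendstoD(2)) (use elim in simp)
          then have "\<forall>\<^sub>F n in sequentially. v x * \<xi> n x = 0"
          proof eventually_elim
            case (elim n)
            then have "x \<notin> ball (r n *\<^sub>R e) (r n / 2)" using ball_norm[of x n] by force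
            then have "\<xi> n x = 0" unfolding \<xi>_def using bump_eq_0_iff[OF r2] by blast
            then show ?case by simp
          qed
          then show ?case by (rule tendsto_eventually)
        qed
        show "integrable lborel v" by (rule v(1))
        show "(\<lambda>x. v x * \<xi> n x) \<in> borel_measurable lborel" for n using vi by blast
      qed simp
      then show ?thesis unfolding M_def[abs_def] by simp
    qed
    have S_le: "S n \<le> B powr (p - 1) * r n powr (- 2 * \<alpha>) * M n" for n
    proof -
      let ?L = "B powr (p - 1) * r n powr (- 2 * \<alpha>)"
      have L: "(B / r n ^ ?n) powr (p - 1) \<le> ?L"
      proof -
        have "(B / r n ^ ?n) powr (p - 1) = B powr (p - 1) * r n powr (- (real ?n * (p - 1)))"
          using r[of n] B by (simp add: powr_divide powr_realpow[symmetric] powr_powr powr_minus_divide)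
        also have "\<dots> \<le> B powr (p - 1) * r n powr (- 2 * \<alpha>)"
        proof (rule mult_left_mono)
          \<comment> \<open>Here the upper bound on \<open>p\<close> enters. As
            \<open>r n <= 1\<close>, the more negative exponent gives the larger power, also in the
            critical case of equality, where the decay of \<open>M\<close> decides.\<close>
          have "real ?n * (p - 1) \<le> 2 * \<alpha>" using assms(6) by (simp add: field_simps)
          then show "r n powr (- (real ?n * (p - 1))) \<le> r n powr (- 2 * \<alpha>)"
            using r[of n] by (intro powr_mono') auto
        qed simp
        finally show ?thesis .
      qed
      have "S n \<le> (LINT x|lborel. ?L * (v x * \<xi> n x))"
        unfolding S_def
      proof (rule integral_mono_AE)
        show "integrable lborel (\<lambda>x. upow (v x) p * \<xi> n x)" unfolding \<xi>_def by (rule vp[OF r2 re])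
        show "integrable lborel (\<lambda>x. ?L * (v x * \<xi> n x))" using vi by (rule integrable_mult_right)
        show "AE x in lborel. upow (v x) p * \<xi> n x \<le> ?L * (v x * \<xi> n x)"
          using vB[OF r(1)[of n] r(2)[of n]]
        proof eventually_elim
          case (elim x)
          show ?case
          proof (cases "x \<in> ball (r n *\<^sub>R e) (r n / 2)")
            case True
            have "upow (v x) p \<le> ?L * v x"
            proof (cases "v x = 0")
              case False
              then have vx: "v x > 0" using v(2)[of x] by simp
              have "upow (v x) p = v x powr (p - 1) * v x"
                using p vx powr_add[of "v x" "p - 1" 1] by (simp add: upow_def)
              also have "v x powr (p - 1) \<le> (B / r n ^ ?n) powr (p - 1)"
                using elim True vx p by (intro powr_mono2) auto
              also note L
              finally show ?thesis using vx by simp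
            qed (use p in \<open>simp add: upow_def\<close>)
            then have "upow (v x) p * \<xi> n x \<le> (?L * v x) * \<xi> n x"
              by (rule mult_right_mono) (simp add: \<xi>_def)
            then show ?thesis by (simp only: mult.assoc)
          next
            case False
            then have "\<xi> n x = 0" unfolding \<xi>_def using bump_eq_0_iff[OF r2] by blast
            then show ?thesis by simp
          qed
        qed
      qed
      then show ?thesis by (simp add: M_def)
    qed
    have "(\<lambda>n. B powr (p - 1) * M n) \<longlonglongrightarrow> B powr (p - 1) * 0" by (intro tendsto_intros M_lim)
    then have "\<forall>\<^sub>F n in sequentially. B powr (p - 1) * M n < c0 * \<kappa> / 2"
      using c0 \<kappa> by (intro order_tendstoD(2)) auto
    with S_ge2 have "\<forall>\<^sub>F n in sequentially. False"
    proof eventually_elim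
      case (elim n)
      have "r n powr (- 2 * \<alpha>) * (c0 * \<kappa> / 2) \<le> r n powr (- 2 * \<alpha>) * (B powr (p - 1) * M n)"
        using elim(1) S_le[of n] by (simp add: mult_ac)
      then have "c0 * \<kappa> / 2 \<le> B powr (p - 1) * M n"
        using r[of n] by (subst (asm) mult_le_cancel_left_pos) auto
      with elim(2) show False by simp
    qed
    then show False by simp
  qed
qed

end
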